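(* Let $\widehat{\mathcal{W}}$ be the set of parallel Weihrauch degrees (the degree $\mathbf{0}$ together with the parallel degrees of all multi-valued functions, between represented spaces in the fixed set $\mathcal{R}$, having at least one computable point in their domain), partially ordered by parallel Weihrauch reducibility $\leq_{\widehat{\mathrm W}}$. Then $(\widehat{\mathcal{W}},\leq_{\widehat{\mathrm W}})$ is a lattice with least element $\mathbf{1}$ and greatest element $\mathbf{0}$, with $\oplus$ as the greatest lower bound operation and with $\times$ as the least upper bound operation. In particular, $(\widehat{\mathcal{W}},\oplus)$ and $(\widehat{\mathcal{W}},\times)$ are idempotent monoids with neutral elements $\mathbf{0}$ and $\mathbf{1}$, respectively.
   Context: A represented space $(X,\delta_X)$ is a set $X$ with a surjective partial map $\delta_X:\subseteq\mathbb{N}^{\mathbb{N}}\to X$; $x\in X$ is computable if $x=\delta_X(p)$ for some computable $p$. A multi-valued function $f:\subseteq X\rightrightarrows Y$ assigns to each $x$ a set $f(x)\subseteq Y$, with $\mathrm{dom}(f)=\{x: f(x)\neq\emptyset\}$. A realizer of $f$ is a partial function $F:\subseteq\mathbb{N}^{\mathbb{N}}\to\mathbb{N}^{\mathbb{N}}$ such that $F(p)$ is defined and $\delta_YF(p)\in f(\delta_X(p))$ for all $p$ with $\delta_X(p)\in\mathrm{dom}(f)$. $f$ is computable if it has a computable realizer. Let $\langle\cdot,\cdot\rangle$ be a computable standard pairing function on $\mathbb{N}^{\mathbb{N}}$, and $\langle p_0,p_1,\dots\rangle$ the computable tupling, $\langle p_0,p_1,\dots\rangle\langle n,k\rangle=p_n(k)$.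 $f\leq_{\mathrm W}g$ iff there are computable $H,K:\subseteq\mathbb{N}^{\mathbb{N}}\to\mathbb{N}^{\mathbb{N}}$ such that for every realizer $G$ of $g$ the function $p\mapsto H\langle p,GK(p)\rangle$ is a realizer of $f$. Parallelization: for $f:\subseteq X\rightrightarrows Y$, $\widehat{f}:\subseteq X^{\mathbb{N}}\rightrightarrows Y^{\mathbb{N}}$, $\widehat{f}((x_i)_{i})=\prod_{i=0}^\infty f(x_i)$, where $X^{\mathbb{N}}$ is represented by $\delta_X^{\mathbb{N}}\langle p_0,p_1,\dots\rangle=(\delta_X(p_i))_{i}$. Parallel reducibility: $f\leq_{\widehat{\mathrm W}}g$ iff $\widehat{f}\leq_{\mathrm W}\widehat{g}$; the classes of the induced equivalence relation are the parallel Weihrauch degrees. Product: for $f:\subseteq X\rightrightarrows Y$, $g:\subseteq U\rightrightarrows V$, $(f\times g)(x,u)=f(x)\times g(u)$ on $\mathrm{dom}(f)\times\mathrm{dom}(g)$; products carry the representation $[\delta_X,\delta_U]\langle p,q\rangle=(\delta_X(p),\delta_U(q))$. Direct sum: $f\oplus g:\subseteq X\times U\rightrightarrows Y\oplus V$, where $Y\oplus V=(\{0\}\times Y)\cup(\{1\}\times V)$, $(f\oplus g)(x,u)=(\{0\}\times f(x))\cup(\{1\}\times g(u))$ on $\mathrm{dom}(f)\times\mathrm{dom}(g)$. $Y\oplus V$ is represented by: $np$ (the sequence $p$ prefixed by $n\in\mathbb{N}$) names $(0,\delta_Y(p))$ if $n=0$ and $(1,\delta_V(p))$ otherwise. $\mathcal{R}$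 is a fixed set of represented spaces that contains $(\mathbb{N}^{\mathbb{N}},\mathrm{id})$ and is closed under products, direct sums and countable powers $X^{\mathbb{N}}$. An extra object $\boldsymbol{\emptyset}$ is added whose set of realizers is declared to be empty; reducibility is extended to it by the same definition (with $\widehat{\boldsymbol\emptyset}=\boldsymbol\emptyset$) and $\mathbf{0}$ denotes its degree. $\widehat{\mathcal{W}}$ consists of $\mathbf{0}$ and all parallel Weihrauch degrees of multi-valued functions $f:\subseteq X\rightrightarrows Y$ with $X,Y\in\mathcal{R}$ and at least one computable point in $\mathrm{dom}(f)$. $\mathbf{1}$ denotes the degree of the computable functions. On parallel degrees, $\times$ is induced by $(f,g)\mapsto f\times g$, whereas $\oplus$ is defined using parallelized representatives, i.e. the sum of the degrees of $f$ and $g$ is the degree of $\widehat{f}\oplus\widehat{g}$. For $\mathbf{0}$ one uses $a\oplus\mathbf{0}=\mathbf{0}\oplus a=a$ and $a\times\mathbf{0}=\mathbf{0}\times a=\mathbf{0}$. *)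

theory Defs
  imports
    "HOL-Library.Nat_Bijection"
    "HOL-Algebra.Group"
    "HOL-Algebra.Lattice"
begin

section \<open>Computability on Baire space\<close>

type_synonym baire = "nat \<Rightarrow> nat"

text \<open>
  Computability is Kleene's: programs for the partial recursive functions, extended by
  a basic instruction that queries an oracle \<open>o \<in> \<nat>\<^sup>\<nat>\<close>.  A program
  applied to the oracle \<open>p\<close> produces the output sequence digit by digit; this is the same
  notion of computability as the one given by Turing machines with infinite input and
  one-way output tapes.
\<close>

datatype prog =
    Zero
  | Succ
  | Proj nat
  | Oracle
  | Comp prog "prog list"
  | PrimRec prog prog
  | Mu prog

inductive computes :: "baire \<Rightarrow> prog \<Rightarrow> nat list \<Rightarrow> nat \<Rightarrow> bool" for p :: baire where
  zero: "computes p Zero xs 0"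
| succ: "computes p Succ (x # xs) (Suc x)"
| proj: "i < length xs \<Longrightarrow> computes p (Proj i) xs (xs ! i)"
| query: "computes p Oracle (x # xs) (p x)"
| comp: "list_all2 (\<lambda>g y. computes p g xs y) gs ys \<Longrightarrow> computes p f ys z
    \<Longrightarrow> computes p (Comp f gs) xs z"
| prim_zero: "computes p f xs y \<Longrightarrow> computes p (PrimRec f g) (0 # xs) y"
| prim_Suc: "computes p (PrimRec f g) (n # xs) y \<Longrightarrow> computes p g (n # y # xs) z
    \<Longrightarrow> computes p (PrimRec f g) (Suc n # xs) z"
| mu: "computes p f (n # xs) 0 \<Longrightarrow> (\<And>m. m < n \<Longrightarrow> \<exists>y. computes p f (m # xs) (Suc y))
    \<Longrightarrow> computes p (Mu f) xs n"

lemma computes_deterministic: "computes p c xs y \<Longrightarrow> computes p c xs z \<Longrightarrow> y = z"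
proof (induction arbitrary: z rule: computes.induct)
  case (comp xs gs ys f y)
  from comp.prems obtain ws where ws: "list_all2 (\<lambda>g y. computes p g xs y) gs ws" "computes p f ws z"
    by (cases rule: computes.cases) auto
  have "ys = ws"
    using comp.IH(1) ws(1) by (auto simp: list_all2_conv_all_nth intro!: nth_equalityI)
  then show ?case using comp.IH(2) ws(2) by blast
next
  case (prim_zero f xs y g)
  from prim_zero.prems show ?case
    by (cases rule: computes.cases) (auto intro: prim_zero.IH)
next
  case (prim_Suc f g n xs y w)
  from prim_Suc.prems obtain y' where "computes p (PrimRec f g) (n # xs) y'" "computes p g (n # y' # xs) z"
    by (cases rule: computes.cases) auto
  then show ?case using prim_Suc.IH by blast
next
  case (mu f n xs)
  from mu.prems have z: "computes p f (z # xs) 0" "\<And>m. m < z \<Longrightarrow> \<exists>y. computes p f (m # xs) (Suc y)"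
    by (cases rule: computes.cases; auto)+
  show ?case
  proof (rule linorder_cases[of n z])
    assume "n < z"
    with z(2) mu.IH(1) show ?thesis by blast
  next
    assume "z < n"
    with z(1) mu.IH(2) show ?thesis by blast
  qed
qed (erule computes.cases, simp_all)+

fun oracle_free :: "prog \<Rightarrow> bool" where
  "oracle_free Oracle \<longleftrightarrow> False"
| "oracle_free (Comp f gs) \<longleftrightarrow> oracle_free f \<and> (\<forall>g\<in>set gs. oracle_free g)"
| "oracle_free (PrimRec f g) \<longleftrightarrow> oracle_free f \<and> oracle_free g"
| "oracle_free (Mu f) \<longleftrightarrow> oracle_free f"
| "oracle_free _ \<longleftrightarrow> True"

text \<open>The oracle in the following definition is immaterial, as it is never queried.\<close>

definition computable_seq :: "baire \<Rightarrow> bool" where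
  "computable_seq p \<longleftrightarrow> (\<exists>c. oracle_free c \<and> (\<forall>n. computes (\<lambda>_. 0) c [n] (p n)))"

text \<open>
  As usual for partial functions on Baire space, nothing is required of the program on
  oracles outside the domain of \<open>F\<close>.  Requiring divergence there would change none of
  the notions below, since enlarging the domain of a realizer gives again a realizer.
\<close>

definition computable_fun :: "(baire \<rightharpoonup> baire) \<Rightarrow> bool" where
  "computable_fun F \<longleftrightarrow> (\<exists>c. \<forall>p q. F p = Some q \<longrightarrow> (\<forall>n. computes p c [n] (q n)))"

text \<open>
  The pairing \<open>\<langle>p, q\<rangle>\<close> interleaves \<open>p\<close> and \<open>q\<close>; the tupling satisfies
  \<open>\<langle>p\<^sub>0, p\<^sub>1, \<dots>\<rangle>\<langle>n, k\<rangle> = p\<^sub>n(k)\<close> with the Cantor pairing \<^const>\<open>prod_encode\<close>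
  on numbers.  Both are bijective, so that representations can be given by projections.
\<close>

definition pairb :: "baire \<Rightarrow> baire \<Rightarrow> baire" where
  "pairb p q = (\<lambda>n. if even n then p (n div 2) else q (n div 2))"

definition fstb :: "baire \<Rightarrow> baire" where
  "fstb r = (\<lambda>n. r (2 * n))"

definition sndb :: "baire \<Rightarrow> baire" where
  "sndb r = (\<lambda>n. r (2 * n + 1))"

definition tupleb :: "(nat \<Rightarrow> baire) \<Rightarrow> baire" where
  "tupleb P = (\<lambda>m. case prod_decode m of (n, k) \<Rightarrow> P n k)"

definition nthb :: "baire \<Rightarrow> nat \<Rightarrow> baire" where
  "nthb r n = (\<lambda>k. r (prod_encode (n, k)))"

lemma fstb_pairb [simp]: "fstb (pairb p q) = p"
  and sndb_pairb [simp]: "sndb (pairb p q) = q"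
  and pairb_fstb_sndb [simp]: "pairb (fstb r) (sndb r) = r"
  by (auto simp: fstb_def sndb_def pairb_def fun_eq_iff)

lemma nthb_tupleb [simp]: "nthb (tupleb P) = P"
  by (simp add: fun_eq_iff nthb_def tupleb_def)

lemma tupleb_nthb [simp]: "tupleb (nthb r) = r"
proof
  fix m
  obtain n k where "prod_decode m = (n, k)" by fastforce
  moreover from this have "prod_encode (n, k) = m" by (metis prod_decode_inverse)
  ultimately show "tupleb (nthb r) m = r m" by (simp add: nthb_def tupleb_def)
qed

section \<open>Represented spaces\<close>

text \<open>
  The points of represented spaces live in one type, so that a set of represented spaces
  can be closed under products, sums and countable powers: hereditary pairs, tagged points
  and sequences over points of Baire space and over atoms of an arbitrary type \<open>'a\<close>.
  \<open>InL y\<close> and \<open>InR v\<close> stand for \<open>(0, y)\<close> and \<open>(1, v)\<close>.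
\<close>

datatype 'a obj =
    Atom 'a
  | Name baire
  | Couple "'a obj" "'a obj"
  | InL "'a obj"
  | InR "'a obj"
  | Seq "nat \<Rightarrow> 'a obj"

record 'a rspace =
  points :: "'a obj set"
  repn :: "baire \<rightharpoonup> 'a obj"

definition represented :: "'a rspace \<Rightarrow> bool" where
  "represented X \<longleftrightarrow> ran (repn X) = points X"

lemma repn_in_points: "represented X \<Longrightarrow> repn X p = Some x \<Longrightarrow> x \<in> points X"
  unfolding represented_def by (metis ranI)

lemma points_repnE:
  assumes "represented X" "x \<in> points X"
  obtains p where "repn X p = Some x"
  using assms unfolding represented_def ran_def by blast

lemma represented_intro:
  assumes "\<And>p x. repn X p = Some x \<Longrightarrow> x \<in> points X"
    and "\<And>x. x \<in> points X \<Longrightarrow> \<exists>p. repn X p = Some x"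
  shows "represented X"
  using assms unfolding represented_def ran_def by blast

definition computable_point :: "'a rspace \<Rightarrow> 'a obj \<Rightarrow> bool" where
  "computable_point X x \<longleftrightarrow> (\<exists>p. computable_seq p \<and> repn X p = Some x)"

definition baire_space :: "'a rspace" where
  "baire_space = \<lparr>points = range Name, repn = (\<lambda>p. Some (Name p))\<rparr>"

definition prod_space :: "'a rspace \<Rightarrow> 'a rspace \<Rightarrow> 'a rspace" where
  "prod_space X U = \<lparr>
     points = {Couple x u | x u. x \<in> points X \<and> u \<in> points U},
     repn = (\<lambda>r. case (repn X (fstb r), repn U (sndb r)) of
               (Some x, Some u) \<Rightarrow> Some (Couple x u) | _ \<Rightarrow> None)\<rparr>"

definition sum_space :: "'a rspace \<Rightarrow> 'a rspace \<Rightarrow> 'a rspace" where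
  "sum_space Y V = \<lparr>
     points = InL ` points Y \<union> InR ` points V,
     repn = (\<lambda>r. if r 0 = 0 then map_option InL (repn Y (\<lambda>n. r (Suc n)))
                  else map_option InR (repn V (\<lambda>n. r (Suc n))))\<rparr>"

definition power_space :: "'a rspace \<Rightarrow> 'a rspace" where
  "power_space X = \<lparr>
     points = {Seq s | s. \<forall>i. s i \<in> points X},
     repn = (\<lambda>r. if \<forall>i. repn X (nthb r i) \<noteq> None
                  then Some (Seq (\<lambda>i. the (repn X (nthb r i)))) else None)\<rparr>"

lemma represented_baire_space: "represented baire_space"
  by (auto simp: represented_def baire_space_def ran_def)

lemma represented_prod_space:
  assumes X: "represented X" and U: "represented U"
  shows "represented (prod_space X U)"
proof (rule represented_intro)
  fix r z assume "repn (prod_space X U) r = Some z"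
  then show "z \<in> points (prod_space X U)"
    using X U by (auto simp: prod_space_def repn_in_points split: option.splits)
next
  fix z assume "z \<in> points (prod_space X U)"
  then obtain x u where z: "z = Couple x u" "x \<in> points X" "u \<in> points U"
    by (auto simp: prod_space_def)
  from X z(2) obtain p where p: "repn X p = Some x" by (rule points_repnE)
  from U z(3) obtain q where q: "repn U q = Some u" by (rule points_repnE)
  have "repn (prod_space X U) (pairb p q) = Some z" by (simp add: prod_space_def z(1) p q)
  then show "\<exists>r. repn (prod_space X U) r = Some z" by blast
qed

lemma represented_sum_space:
  assumes Y: "represented Y" and V: "represented V"
  shows "represented (sum_space Y V)"
proof (rule represented_intro)
  fix r z assume "repn (sum_space Y V) r = Some z"
  then show "z \<in> points (sum_space Y V)"
    using Y V by (auto simp: sum_space_def repn_in_points split: if_splits)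
next
  fix z assume "z \<in> points (sum_space Y V)"
  then consider y where "z = InL y" "y \<in> points Y" | v where "z = InR v" "v \<in> points V"
    by (auto simp: sum_space_def)
  then show "\<exists>r. repn (sum_space Y V) r = Some z"
  proof cases
    case 1
    from Y 1(2) obtain p where "repn Y p = Some y" by (rule points_repnE)
    then have "repn (sum_space Y V) (case_nat 0 p) = Some z" by (simp add: sum_space_def 1(1))
    then show ?thesis by blast
  next
    case 2
    from V 2(2) obtain p where "repn V p = Some v" by (rule points_repnE)
    then have "repn (sum_space Y V) (case_nat 1 p) = Some z" by (simp add: sum_space_def 2(1))
    then show ?thesis by blast
  qed
qed

lemma represented_power_space:
  assumes X: "represented X"
  shows "represented (power_space X)"
proof (rule represented_intro)
  fix r z assume "repn (power_space X) r = Some z"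
  then have r: "\<forall>i. repn X (nthb r i) \<noteq> None" "z = Seq (\<lambda>i. the (repn X (nthb r i)))"
    unfolding power_space_def by (simp_all split: if_split_asm)
  have "the (repn X (nthb r i)) \<in> points X" for i
    using r(1) X by (metis option.collapse repn_in_points)
  with r(2) show "z \<in> points (power_space X)" by (auto simp: power_space_def)
next
  fix z assume "z \<in> points (power_space X)"
  then obtain s where s: "z = Seq s" "\<forall>i. s i \<in> points X" by (auto simp: power_space_def)
  then have "\<forall>i. \<exists>p. repn X p = Some (s i)" using X by (metis points_repnE)
  then obtain P where "\<forall>i. repn X (P i) = Some (s i)" by metis
  then have "repn (power_space X) (tupleb P) = Some z" by (simp add: power_space_def s(1))
  then show "\<exists>r. repn (power_space X) r = Some z" by blast
qed

definition admissible :: "'a rspace set \<Rightarrow> bool" where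
  "admissible R \<longleftrightarrow>
     (\<forall>X\<in>R. represented X) \<and>
     baire_space \<in> R \<and>
     (\<forall>X\<in>R. \<forall>Y\<in>R. prod_space X Y \<in> R) \<and>
     (\<forall>X\<in>R. \<forall>Y\<in>R. sum_space X Y \<in> R) \<and>
     (\<forall>X\<in>R. power_space X \<in> R)"

lemma admissible_all: "admissible {X. represented X}"
  by (simp add: admissible_def represented_baire_space represented_prod_space
      represented_sum_space represented_power_space)

section \<open>Multi-valued functions\<close>

record 'a mvfun =
  src :: "'a rspace"
  tgt :: "'a rspace"
  vals :: "'a obj \<Rightarrow> 'a obj set"

definition mdom :: "'a mvfun \<Rightarrow> 'a obj set" where
  "mdom f = {x. vals f x \<noteq> {}}"

definition wf_mvfun :: "'a mvfun \<Rightarrow> bool" where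
  "wf_mvfun f \<longleftrightarrow> mdom f \<subseteq> points (src f) \<and> (\<forall>x. vals f x \<subseteq> points (tgt f))"

definition realizes :: "(baire \<rightharpoonup> baire) \<Rightarrow> 'a mvfun \<Rightarrow> bool" where
  "realizes F f \<longleftrightarrow> (\<forall>p x. repn (src f) p = Some x \<and> x \<in> mdom f \<longrightarrow>
     (\<exists>q y. F p = Some q \<and> repn (tgt f) q = Some y \<and> y \<in> vals f x))"

definition computable_mvfun :: "'a mvfun \<Rightarrow> bool" where
  "computable_mvfun f \<longleftrightarrow> (\<exists>F. computable_fun F \<and> realizes F f)"

definition has_computable_point :: "'a mvfun \<Rightarrow> bool" where
  "has_computable_point f \<longleftrightarrow> (\<exists>x\<in>mdom f. computable_point (src f) x)"

definition parallel_mv :: "'a mvfun \<Rightarrow> 'a mvfun" where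
  "parallel_mv f = \<lparr>src = power_space (src f), tgt = power_space (tgt f),
     vals = (\<lambda>z. {Seq t | s t. z = Seq s \<and> (\<forall>i. t i \<in> vals f (s i))})\<rparr>"

definition prod_mv :: "'a mvfun \<Rightarrow> 'a mvfun \<Rightarrow> 'a mvfun" where
  "prod_mv f g = \<lparr>src = prod_space (src f) (src g), tgt = prod_space (tgt f) (tgt g),
     vals = (\<lambda>z. {Couple y v | x u y v. z = Couple x u \<and> y \<in> vals f x \<and> v \<in> vals g u})\<rparr>"

definition sum_mv :: "'a mvfun \<Rightarrow> 'a mvfun \<Rightarrow> 'a mvfun" where
  "sum_mv f g = \<lparr>src = prod_space (src f) (src g), tgt = sum_space (tgt f) (tgt g),
     vals = (\<lambda>z. {w. \<exists>x u. z = Couple x u \<and> x \<in> mdom f \<and> u \<in> mdom g \<and>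
                       w \<in> InL ` vals f x \<union> InR ` vals g u})\<rparr>"

text \<open>The constructor \<open>Void\<close> is the additional object without realizer.\<close>

datatype 'a problem = Void | Fn "'a mvfun"

fun realizer_set :: "'a problem \<Rightarrow> (baire \<rightharpoonup> baire) set" where
  "realizer_set Void = {}"
| "realizer_set (Fn f) = {F. realizes F f}"

fun parallel :: "'a problem \<Rightarrow> 'a problem" where
  "parallel Void = Void"
| "parallel (Fn f) = Fn (parallel_mv f)"

fun prod_prob :: "'a problem \<Rightarrow> 'a problem \<Rightarrow> 'a problem" where
  "prod_prob (Fn f) (Fn g) = Fn (prod_mv f g)"
| "prod_prob _ _ = Void"

text \<open>The direct sum of the parallelizations, extended by \<open>a \<oplus> 0 = 0 \<oplus> a = a\<close>.\<close>

fun psum_prob :: "'a problem \<Rightarrow> 'a problem \<Rightarrow> 'a problem" where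
  "psum_prob (Fn f) (Fn g) = Fn (sum_mv (parallel_mv f) (parallel_mv g))"
| "psum_prob Void g = g"
| "psum_prob f Void = f"

section \<open>Parallel Weihrauch degrees\<close>

definition weihrauch_le :: "'a problem \<Rightarrow> 'a problem \<Rightarrow> bool" (infix \<open>\<le>\<^sub>W\<close> 50) where
  "f \<le>\<^sub>W g \<longleftrightarrow> (\<exists>H K. computable_fun H \<and> computable_fun K \<and>
     (\<forall>G\<in>realizer_set g.
        (\<lambda>p. Option.bind (Option.bind (K p) G) (\<lambda>r. H (pairb p r))) \<in> realizer_set f))"

definition parallel_le :: "'a problem \<Rightarrow> 'a problem \<Rightarrow> bool" (infix \<open>\<le>\<^sub>P\<close> 50) where
  "f \<le>\<^sub>P g \<longleftrightarrow> parallel f \<le>\<^sub>W parallel g"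

definition problems :: "'a rspace set \<Rightarrow> 'a problem set" where
  "problems R = insert Void {Fn f | f. src f \<in> R \<and> tgt f \<in> R \<and> wf_mvfun f}"

definition parallel_equiv :: "'a rspace set \<Rightarrow> ('a problem \<times> 'a problem) set" where
  "parallel_equiv R = {(f, g). f \<in> problems R \<and> g \<in> problems R \<and> f \<le>\<^sub>P g \<and> g \<le>\<^sub>P f}"

definition degree :: "'a rspace set \<Rightarrow> 'a problem \<Rightarrow> 'a problem set" where
  "degree R f = parallel_equiv R `` {f}"

definition zero_degree :: "'a rspace set \<Rightarrow> 'a problem set" where
  "zero_degree R = degree R Void"

definition W_hat :: "'a rspace set \<Rightarrow> 'a problem set set" where
  "W_hat R = insert (zero_degree R)
     {degree R (Fn f) | f. Fn f \<in> problems R \<and> has_computable_point f}"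

text \<open>
  A computable function without computable points in its domain, such as the nowhere defined
  one, need not be equivalent to the identity; its degree does not belong to \<open>W_hat R\<close>.
\<close>

definition one_degree :: "'a rspace set \<Rightarrow> 'a problem set" where
  "one_degree R = {Fn f | f. Fn f \<in> problems R \<and> has_computable_point f \<and> computable_mvfun f}"

text \<open>
  The induced order and operations on degrees.  The unions range over all representatives;
  if an operation were not independent of them, the union would fail to be a single degree.
\<close>

definition degree_le :: "'a problem set \<Rightarrow> 'a problem set \<Rightarrow> bool" where
  "degree_le a b \<longleftrightarrow> (\<exists>f\<in>a. \<exists>g\<in>b. f \<le>\<^sub>P g)"

definition degree_prod :: "'a rspace set \<Rightarrow> 'a problem set \<Rightarrow> 'a problem set \<Rightarrow> 'a problem set"
  where "degree_prod R a b = (\<Union>f\<in>a. \<Union>g\<in>b. degree R (prod_prob f g))"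

definition degree_sum :: "'a rspace set \<Rightarrow> 'a problem set \<Rightarrow> 'a problem set \<Rightarrow> 'a problem set"
  where "degree_sum R a b = (\<Union>f\<in>a. \<Union>g\<in>b. degree R (psum_prob f g))"

abbreviation W_hat_order :: "'a rspace set \<Rightarrow> 'a problem set gorder" where
  "W_hat_order R \<equiv> \<lparr>carrier = W_hat R, eq = (=), le = degree_le\<rparr>"

end

theory Submission
  imports Defs
begin

text \<open>
  Reducibility of problems is best studied on names.  Eliminating realizers, a problem becomes a
  relation \<open>S\<close> between the names of its instances and the names of their solutions, and
  \<open>S\<close> reduces to \<open>T\<close> if computable functions translate instances of \<open>S\<close> into instances of
  \<open>T\<close> and, given the original instance, solutions back (\<open>weihrauch_le_Fn_iff\<close>).
  Parallelization, product and sum are simple operations on such relations.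

  Parallelization is a closure operator: it is extensive, monotone and idempotent
  (\<open>par_rel_extensive\<close>, \<open>par_rel_mono\<close>, \<open>par_rel_idempotent\<close>), so parallel reducibility is
  the reducibility of closed problems.  A closed problem can answer two instances of itself at
  once, by merging two sequences of instances into one (\<open>prod_rel_par_rel\<close>); therefore a product
  lies below every closed problem above both factors.  It lies above each factor because the
  other factor can be fed with a fixed computable instance (\<open>rel_le_prod_left\<close>).  The sum
  answers one of its two instances, so that it lies below both summands, and it lies above every
  problem that reduces to both: instances for both are submitted, and the tag of the answer
  says which reduction to finish (\<open>sum_rel_greatest\<close>).  Since the summands of a sum
  of degrees are closed, the sum stays below them after parallelization.

  The least element consists of the computable problems because such problems can be solved with
  no help, provided that some computable instance of the other problem can be submitted
  (\<open>computable_rel_le\<close>).  The greatest element is the problem without realizer, to which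
  everything reduces vacuously.  The monoid laws follow from the order alone
  (\<open>lub_operation_monoid\<close>).

  On the side of computability, the translations that occur are of two kinds.  Rearrangements
  of the entries of a sequence are total and are obtained from a stock of elementary functionals,
  including the decoding of pairs of numbers.  The partial functions \<open>H\<close> and \<open>K\<close> of given
  reductions are combined by composition, pairing, a lazy definition by cases and application to
  all components of a sequence; the last one requires running a program on an oracle that is
  computed from the given oracle and a number (\<open>computes_relativize\<close>).
\<close>

section \<open>Functionals that are total in the oracle\<close>

text \<open>
  The argument list has a fixed length \<open>k\<close> because the
  auxiliary programs that pass arguments on have to name each of them by a projection.
\<close>

definition functional :: "nat \<Rightarrow> (baire \<Rightarrow> nat list \<Rightarrow> nat) \<Rightarrow> bool" where
  "functional k \<phi> \<longleftrightarrow> (\<exists>c. \<forall>p xs. length xs = k \<longrightarrow> computes p c xs (\<phi> p xs))"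

lemma functional_comp:
  assumes "functional (length as) \<phi>" "\<forall>a\<in>set as. functional k a"
  shows "functional k (\<lambda>p xs. \<phi> p (map (\<lambda>a. a p xs) as))"
proof -
  obtain c where c: "\<And>p ys. length ys = length as \<Longrightarrow> computes p c ys (\<phi> p ys)"
    using assms(1) unfolding functional_def by blast
  obtain C where C: "\<forall>a\<in>set as. \<forall>p xs. length xs = k \<longrightarrow> computes p (C a) xs (a p xs)"
    using assms(2) unfolding functional_def by metis
  have "computes p (Comp c (map C as)) xs (\<phi> p (map (\<lambda>a. a p xs) as))" if "length xs = k" for p xs
    using that C by (intro computes.comp[OF _ c]) (auto simp: list_all2_conv_all_nth)
  then show ?thesis unfolding functional_def by blast
qed

lemma functional_comp1:
  assumes "functional 1 (\<lambda>p xs. F p (xs ! 0))" "functional k a"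
  shows "functional k (\<lambda>p xs. F p (a p xs))"
  using functional_comp[of "[a]" "\<lambda>p xs. F p (xs ! 0)" k] assms by simp

lemma functional_comp2:
  assumes "functional 2 (\<lambda>p xs. F p (xs ! 0) (xs ! 1))" "functional k a" "functional k b"
  shows "functional k (\<lambda>p xs. F p (a p xs) (b p xs))"
  using functional_comp[of "[a, b]" "\<lambda>p xs. F p (xs ! 0) (xs ! 1)" k] assms
  by (simp add: numeral_2_eq_2)

lemma functional_proj: "i < k \<Longrightarrow> functional k (\<lambda>p xs. xs ! i)"
  unfolding functional_def by (metis computes.proj)

lemma functional_query: "functional k a \<Longrightarrow> functional k (\<lambda>p xs. p (a p xs))"
proof (rule functional_comp1[where F = "\<lambda>p. p"])
  have "computes p Oracle xs (p (xs ! 0))" if "length xs = 1" for p xs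
    using that by (cases xs) (auto intro: computes.query)
  then show "functional 1 (\<lambda>p xs. p (xs ! 0))" unfolding functional_def by blast
qed

lemma functional_Suc: "functional k a \<Longrightarrow> functional k (\<lambda>p xs. Suc (a p xs))"
proof (rule functional_comp1[where F = "\<lambda>p. Suc"])
  have "computes p Succ xs (Suc (xs ! 0))" if "length xs = 1" for p xs
    using that by (cases xs) (auto intro: computes.succ)
  then show "functional 1 (\<lambda>p xs. Suc (xs ! 0))" unfolding functional_def by blast
qed

lemma functional_const: "functional k (\<lambda>p xs. n)"
proof (induction n)
  case 0
  show ?case unfolding functional_def by (metis computes.zero)
qed (rule functional_Suc)

lemma functional_primrec:
  assumes base: "functional 1 (\<lambda>p xs. f (xs ! 0))"
    and step: "functional 3 (\<lambda>p xs. g (xs ! 0) (xs ! 1) (xs ! 2))"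
    and h0: "\<And>y. h 0 y = f y" and hSuc: "\<And>n y. h (Suc n) y = g n (h n y) y"
  shows "functional 2 (\<lambda>p xs. h (xs ! 0) (xs ! 1))"
proof -
  obtain c where c: "\<And>p xs. length xs = 1 \<Longrightarrow> computes p c xs (f (xs ! 0))"
    using base unfolding functional_def by blast
  obtain d where d: "\<And>p xs. length xs = 3 \<Longrightarrow> computes p d xs (g (xs ! 0) (xs ! 1) (xs ! 2))"
    using step unfolding functional_def by blast
  have "computes p (PrimRec c d) [n, y] (h n y)" for p n y
  proof (induction n)
    case 0
    show ?case using c[of "[y]" p] by (auto intro: computes.prim_zero simp: h0)
  next
    case (Suc n)
    from Suc.IH show ?case
      using d[of "[n, h n y, y]" p] by (auto intro: computes.prim_Suc simp: hSuc)
  qed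
  moreover have "xs = [xs ! 0, xs ! 1]" if "length xs = 2" for xs :: "nat list"
    using that by (auto simp: numeral_2_eq_2 length_Suc_conv)
  ultimately show ?thesis unfolding functional_def by metis
qed

lemma functional_add: "functional k a \<Longrightarrow> functional k b \<Longrightarrow> functional k (\<lambda>p xs. a p xs + b p xs)"
  by (rule functional_comp2[where F = "\<lambda>p m n. m + n"],
      rule functional_primrec[where f = "\<lambda>y. y" and g = "\<lambda>n r y. Suc r"])
    (auto intro!: functional_Suc functional_proj)

lemma functional_recursion:
  assumes "functional 2 (\<lambda>p xs. g (xs ! 0) (xs ! 1))"
    and "h 0 = z" "\<And>n. h (Suc n) = g n (h n)" and "functional k a"
  shows "functional k (\<lambda>p xs. h (a p xs))"
proof (rule functional_comp2[where F = "\<lambda>p m n. h m" and b = a])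
  have "functional 3 (\<lambda>p xs. g (xs ! 0) (xs ! 1))"
    by (rule functional_comp2[where F = "\<lambda>p. g", OF assms(1)]) (auto intro: functional_proj)
  then show "functional 2 (\<lambda>p xs. h (xs ! 0))"
    by (intro functional_primrec[where f = "\<lambda>y. z" and g = "\<lambda>n r y. g n r"])
      (auto simp: assms functional_const)
qed (fact assms(4))+

lemma functional_pred: "functional k a \<Longrightarrow> functional k (\<lambda>p xs. a p xs - 1)"
  by (rule functional_recursion[where g = "\<lambda>n r. n" and h = "\<lambda>n. n - 1" and z = 0])
    (auto intro: functional_proj)

lemma functional_diff: "functional k a \<Longrightarrow> functional k b \<Longrightarrow> functional k (\<lambda>p xs. a p xs - b p xs)"
proof (rule functional_comp2[where F = "\<lambda>p n m. m - n" and a = b and b = a])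
  have "functional 3 (\<lambda>p xs. xs ! 1 - 1)"
    by (rule functional_pred) (simp add: functional_proj)
  then show "functional 2 (\<lambda>p xs. xs ! 1 - xs ! 0)"
    by (intro functional_primrec[where f = "\<lambda>y. y" and g = "\<lambda>n r y. r - 1" and h = "\<lambda>n m. m - n"])
      (auto intro: functional_proj)
qed auto

lemma functional_mod2: "functional k a \<Longrightarrow> functional k (\<lambda>p xs. a p xs mod 2)"
  by (rule functional_recursion[where g = "\<lambda>n r. 1 - r" and h = "\<lambda>n. n mod 2" and z = 0])
    (auto intro!: functional_diff functional_const functional_proj simp: mod_Suc)

lemma functional_div2: "functional k a \<Longrightarrow> functional k (\<lambda>p xs. a p xs div 2)"
  by (rule functional_recursion[where g = "\<lambda>n r. r + n mod 2" and h = "\<lambda>n. n div 2" and z = 0])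
    (auto intro!: functional_add functional_mod2 functional_proj, arith)

lemma functional_double: "functional k a \<Longrightarrow> functional k (\<lambda>p xs. 2 * a p xs)"
  using functional_add[of k a a] by (simp add: mult_2)

lemma functional_triangle: "functional k a \<Longrightarrow> functional k (\<lambda>p xs. triangle (a p xs))"
  by (rule functional_recursion[where g = "\<lambda>n r. r + Suc n" and h = triangle and z = 0])
    (auto intro!: functional_add functional_Suc functional_proj)

lemma functional_prod_encode:
  "functional k a \<Longrightarrow> functional k b \<Longrightarrow> functional k (\<lambda>p xs. prod_encode (a p xs, b p xs))"
  unfolding prod_encode_def by (auto intro!: functional_add functional_triangle)

lemma functional_Least:
  assumes f: "functional 2 (\<lambda>p xs. f (xs ! 0) (xs ! 1))"
    and ex: "\<And>m. \<exists>s. f s m = 0" and a: "functional k a"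
  shows "functional k (\<lambda>p xs. LEAST s. f s (a p xs) = 0)"
proof (rule functional_comp1[where F = "\<lambda>p m. LEAST s. f s m = 0", OF _ a])
  obtain c where "\<And>p xs. length xs = 2 \<Longrightarrow> computes p c xs (f (xs ! 0) (xs ! 1))"
    using f unfolding functional_def by blast
  then have c: "computes p c [s, m] (f s m)" for p s m
    by (metis One_nat_def length_Cons list.size(3) nth_Cons_0 nth_Cons_Suc numeral_2_eq_2)
  have "computes p (Mu c) [m] (LEAST s. f s m = 0)" for p m
  proof (rule computes.mu)
    have "f (LEAST s. f s m = 0) m = 0" using ex[of m] by (rule LeastI_ex)
    then show "computes p c [LEAST s. f s m = 0, m] 0" using c by metis
  next
    fix i assume "i < (LEAST s. f s m = 0)"
    then have "f i m \<noteq> 0" by (rule not_less_Least)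
    then obtain y where "f i m = Suc y" using not0_implies_Suc by blast
    then show "\<exists>y. computes p c [i, m] (Suc y)" using c by metis
  qed
  moreover have "xs = [xs ! 0]" if "length xs = 1" for xs :: "nat list"
    using that by (auto simp: length_Suc_conv)
  ultimately show "functional 1 (\<lambda>p xs. LEAST s. f s (xs ! 0) = 0)"
    unfolding functional_def by metis
qed

text \<open>
  The pair coded by \<open>m\<close> lies on the diagonal whose index is the least \<open>s\<close> with
  \<open>m < triangle (Suc s)\<close>.
\<close>

lemma diagonal_index:
  "(LEAST s. Suc (prod_encode (x, y)) - triangle (Suc s) = 0) = x + y"
proof (rule Least_equality)
  show "Suc (prod_encode (x, y)) - triangle (Suc (x + y)) = 0" by (simp add: prod_encode_def)
next
  fix s assume s: "Suc (prod_encode (x, y)) - triangle (Suc s) = 0"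
  show "x + y \<le> s"
  proof (rule ccontr)
    assume "\<not> x + y \<le> s"
    then have "triangle (Suc s) \<le> triangle (x + y)"
      unfolding triangle_def by (intro div_le_mono mult_le_mono) auto
    with s show False by (simp add: prod_encode_def)
  qed
qed

lemma functional_prod_decode:
  assumes a: "functional k a"
  shows functional_fst_decode: "functional k (\<lambda>p xs. fst (prod_decode (a p xs)))"
    and functional_snd_decode: "functional k (\<lambda>p xs. snd (prod_decode (a p xs)))"
proof -
  define diag where "diag m = (LEAST s. Suc m - triangle (Suc s) = 0)" for m
  have diag: "diag m = fst (prod_decode m) + snd (prod_decode m)" for m
    unfolding diag_def using diagonal_index[of "fst (prod_decode m)" "snd (prod_decode m)"] by simp
  have m: "m = triangle (diag m) + fst (prod_decode m)" for m
  proof -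
    have "m = prod_encode (fst (prod_decode m), snd (prod_decode m))" by simp
    then show ?thesis unfolding diag prod_encode_def by (simp only: case_prod_beta fst_conv snd_conv)
  qed
  have D: "functional k (\<lambda>p xs. diag (a p xs))"
    unfolding diag_def
  proof (rule functional_Least[OF _ _ a])
    show "functional 2 (\<lambda>p xs. Suc (xs ! 1) - triangle (Suc (xs ! 0)))"
      by (intro functional_diff functional_Suc functional_triangle functional_proj) auto
    show "\<exists>s. Suc m - triangle (Suc s) = 0" for m
      by (rule exI[of _ m]) simp
  qed
  have F: "fst (prod_decode m) = m - triangle (diag m)" for m using m[of m] by simp
  have S: "snd (prod_decode m) = diag m - fst (prod_decode m)" for m using diag[of m] by simp
  show 1: "functional k (\<lambda>p xs. fst (prod_decode (a p xs)))"
    unfolding F by (intro functional_diff functional_triangle a D)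
  show "functional k (\<lambda>p xs. snd (prod_decode (a p xs)))"
    unfolding S by (intro functional_diff 1 D)
qed

text \<open>
  Both branches are evaluated, which is harmless as long as they are total; partial branches are
  treated by \<open>lazy_conditional\<close> below.
\<close>

lemma functional_if:
  assumes "functional k t" "functional k a" "functional k b"
  shows "functional k (\<lambda>p xs. if t p xs = 0 then a p xs else b p xs)"
proof -
  have g: "functional k (\<lambda>p xs. case_nat (u p xs) (\<lambda>_. 0) (t p xs))" if u: "functional k u" "functional k t" for u t
    by (rule functional_comp2[where F = "\<lambda>p n y. case_nat y (\<lambda>_. 0) n", OF _ u(2) u(1)],
        rule functional_primrec[where f = "\<lambda>y. y" and g = "\<lambda>n r y. 0"])
      (auto intro: functional_proj functional_const)
  have "functional k (\<lambda>p xs. case_nat (a p xs) (\<lambda>_. 0) (t p xs)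
      + case_nat (b p xs) (\<lambda>_. 0) (1 - t p xs))"
    by (intro functional_add g functional_diff functional_const assms)
  moreover have "case_nat (a p xs) (\<lambda>_. 0) (t p xs) + case_nat (b p xs) (\<lambda>_. 0) (1 - t p xs)
      = (if t p xs = 0 then a p xs else b p xs)" for p xs
    by (simp split: nat.split)
  ultimately show ?thesis by simp
qed

lemma functional_if_even:
  assumes "functional k t" "functional k a" "functional k b"
  shows "functional k (\<lambda>p xs. if even (t p xs) then a p xs else b p xs)"
  using functional_if[OF functional_mod2 assms(2,3), OF assms(1)]
  by (simp add: even_iff_mod_2_eq_zero)

lemmas functional_intros =
  functional_if_even functional_if functional_prod_encode functional_fst_decode functional_snd_decode
  functional_double functional_div2 functional_Suc functional_diff functional_add
  functional_query functional_proj functional_const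

section \<open>Closure properties of the computable partial functions\<close>

text \<open>
  Running a program \<open>c\<close> on an oracle that is itself computed by a program \<open>Q\<close>.  In the tuplings
  below the new oracle depends on a number \<open>n\<close>, which every subprogram must be able to read;
  it is carried as an additional last argument, so that the arguments used by recursion and
  search keep their positions.  The place of \<open>n\<close> is the arity \<open>a\<close>, which is known statically.
\<close>

fun relativize :: "prog \<Rightarrow> nat \<Rightarrow> prog \<Rightarrow> prog" where
  "relativize Q a Oracle = Comp Q [Proj 0, Proj a]"
| "relativize Q a (Comp f gs) = Comp (relativize Q (length gs) f) (map (relativize Q a) gs @ [Proj a])"
| "relativize Q a (PrimRec f g) = PrimRec (relativize Q (a - 1) f) (relativize Q (Suc a) g)"
| "relativize Q a (Mu f) = Mu (relativize Q (Suc a) f)"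
| "relativize Q a c = c"

lemma computes_relativize:
  assumes "computes q c xs y" and Q: "\<And>x. computes p Q [x, n] (q x)"
  shows "computes p (relativize Q (length xs) c) (xs @ [n]) y"
  using assms(1)
proof induction
  case (proj i xs)
  then show ?case using computes.proj[of i "xs @ [n]" p] by (simp add: nth_append)
next
  case (query x xs)
  have "list_all2 (\<lambda>g y. computes p g ((x # xs) @ [n]) y) [Proj 0, Proj (length (x # xs))] [x, n]"
    using computes.proj[of 0 "(x # xs) @ [n]" p]
      computes.proj[of "length (x # xs)" "(x # xs) @ [n]" p] by (simp add: nth_append)
  then show ?case using Q by (auto intro: computes.comp)
next
  case (comp xs gs ys f z)
  have len: "length gs = length ys" using comp.IH(1) by (rule list_all2_lengthD)
  have n: "computes p (Proj (length xs)) (xs @ [n]) n"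
    using computes.proj[of "length xs" "xs @ [n]" p] by simp
  have "list_all2 (\<lambda>g y. computes p g (xs @ [n]) y)
      (map (relativize Q (length xs)) gs @ [Proj (length xs)]) (ys @ [n])"
    using comp.IH(1) n by (intro list_all2_appendI) (auto simp: list.rel_map elim: list_all2_mono)
  then show ?case using comp.IH(2) by (auto simp: len intro: computes.comp)
next
  case (mu f m xs)
  then show ?case by (auto intro!: computes.mu)
qed (auto intro: computes.intros)

lemma oracle_free_relativize: "oracle_free Q \<Longrightarrow> oracle_free (relativize Q a c)"
  by (induction Q a c rule: relativize.induct) auto

lemma computes_oracle_free: "computes p c xs y \<Longrightarrow> oracle_free c \<Longrightarrow> computes q c xs y"
proof (induction rule: computes.induct)
  case (comp xs gs ys f z)
  have "list_all2 (\<lambda>g y. computes q g xs y) gs ys"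
    using comp.IH(1) comp.prems by (auto simp: list_all2_conv_all_nth)
  then show ?case using comp by (auto intro: computes.comp)
next
  case (mu f n xs)
  then show ?case by (auto intro!: computes.mu)
qed (auto intro: computes.intros)

definition produces :: "prog \<Rightarrow> baire \<Rightarrow> baire \<Rightarrow> bool" where
  "produces c p q \<longleftrightarrow> (\<forall>n. computes p c [n] (q n))"

lemma computable_fun_iff: "computable_fun F \<longleftrightarrow> (\<exists>c. \<forall>p q. F p = Some q \<longrightarrow> produces c p q)"
  by (simp add: computable_fun_def produces_def)

lemma functionalE:
  assumes "functional 1 (\<lambda>p xs. F p (xs ! 0))"
  obtains c where "\<And>p x. computes p c [x] (F p x)"
  using assms unfolding functional_def
  by (metis One_nat_def length_Cons list.size(3) nth_Cons_0)

lemma computable_total: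
  assumes "functional 1 (\<lambda>p xs. F p (xs ! 0))"
  shows "computable_fun (\<lambda>p. Some (F p))"
  using assms by (elim functionalE) (auto simp: computable_fun_iff produces_def)

lemma computes_Comp1: "computes p d [x] y \<Longrightarrow> computes p c [y] z \<Longrightarrow> computes p (Comp c [d]) [x] z"
  by (rule computes.comp[where ys = "[y]"]) auto

text \<open>
  Composition of the functions computed by two programs is the case of relativization in which
  the new oracle is independent of the additional argument, here \<open>0\<close>.
\<close>

lemma produces_relativize:
  assumes c: "produces c r q" and d: "produces d p r"
  shows "produces (Comp (relativize (Comp d [Proj 0]) 1 c) [Proj 0, Zero]) p q"
  unfolding produces_def
proof
  fix n
  have "computes p (Comp d [Proj 0]) [x, 0] (r x)" for x
    using d computes.proj[of 0 "[x, 0]" p]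
    by (intro computes.comp[where ys = "[x]"]) (auto simp: produces_def)
  moreover have "computes r c [n] (q n)" using c by (simp add: produces_def)
  ultimately have "computes p (relativize (Comp d [Proj 0]) 1 c) [n, 0] (q n)"
    using computes_relativize[of r c "[n]" "q n" p _ 0] by simp
  then show "computes p (Comp (relativize (Comp d [Proj 0]) 1 c) [Proj 0, Zero]) [n] (q n)"
    using computes.proj[of 0 "[n]" p]
    by (intro computes.comp[where ys = "[n, 0]"]) (auto intro: computes.zero)
qed

lemma computable_bind:
  assumes "computable_fun F" "computable_fun G"
  shows "computable_fun (\<lambda>p. Option.bind (F p) G)"
proof -
  obtain d where d: "\<And>p q. F p = Some q \<Longrightarrow> produces d p q"
    using assms(1) unfolding computable_fun_iff by blast
  obtain c where c: "\<And>p q. G p = Some q \<Longrightarrow> produces c p q"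
    using assms(2) unfolding computable_fun_iff by blast
  show ?thesis unfolding computable_fun_iff
    by (rule exI[of _ "Comp (relativize (Comp d [Proj 0]) 1 c) [Proj 0, Zero]"])
      (auto simp: bind_eq_Some_conv simp del: One_nat_def intro!: produces_relativize dest: c d)
qed

text \<open>
  This is what makes parallelization monotone: to find the entry \<open>k\<close> of the \<open>n\<close>-th output
  sequence, the program for \<open>F\<close> is run on \<open>k\<close>, relativized to the \<open>n\<close>-th component of the oracle.
\<close>

lemma computable_tuple:
  assumes "computable_fun F"
  shows "computable_fun (\<lambda>p. if \<forall>n. F (nthb p n) \<noteq> None
           then Some (tupleb (\<lambda>n. the (F (nthb p n)))) else None)"
proof -
  obtain c where c: "\<And>p q. F p = Some q \<Longrightarrow> produces c p q"
    using assms unfolding computable_fun_iff by blast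
  have "functional 2 (\<lambda>p xs. p (prod_encode (xs ! 1, xs ! 0)))"
    by (intro functional_intros) auto
  then obtain Q where Q: "\<And>p xs. length xs = 2 \<Longrightarrow> computes p Q xs (p (prod_encode (xs ! 1, xs ! 0)))"
    unfolding functional_def by blast
  have Q: "computes p Q [x, n] (nthb p n x)" for p x n
    using Q[of "[x, n]" p] by (simp add: nthb_def)
  have "functional 1 (\<lambda>p xs. fst (prod_decode (xs ! 0)))"
    "functional 1 (\<lambda>p xs. snd (prod_decode (xs ! 0)))"
    by (intro functional_intros; simp)+
  then obtain f s where f: "\<And>p x. computes p f [x] (fst (prod_decode x))"
    and s: "\<And>p x. computes p s [x] (snd (prod_decode x))"
    by (elim functionalE) blast
  have "produces (Comp (relativize Q 1 c) [s, f]) p (tupleb P)"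
    if P: "\<And>n. F (nthb p n) = Some (P n)" for p P
    unfolding produces_def
  proof
    fix m
    obtain n k where m: "prod_decode m = (n, k)" by fastforce
    have "computes (nthb p n) c [k] (P n k)" using c[OF P] by (simp add: produces_def)
    then have "computes p (relativize Q 1 c) [k, n] (P n k)"
      using computes_relativize[OF _ Q, of p n c "[k]"] by simp
    then show "computes p (Comp (relativize Q 1 c) [s, f]) [m] (tupleb P m)"
      using s[of p m] f[of p m]
      by (intro computes.comp[where ys = "[k, n]"]) (auto simp: m tupleb_def)
  qed
  then show ?thesis unfolding computable_fun_iff
    by (intro exI[of _ "Comp (relativize Q 1 c) [s, f]"]) (auto split: if_splits)
qed

text \<open>
  Primitive recursion evaluates its base case even when the recursion argument is positive, so a
  definition by cases obtained from it would diverge as soon as one branch does.  Each branch is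
  therefore guarded separately: it is placed in the recursion step and executed exactly if the
  guard is \<open>1\<close>, while the base case is the constant \<open>0\<close>; the guarded values are then added.
\<close>

lemma computes_guarded:
  assumes "computes p b [x] v" "v = 0 \<or> v = 1 \<and> computes p c [x] y"
  shows "computes p (Comp (PrimRec Zero (Comp c [Proj 2])) [b, Proj 0]) [x] (if v = 0 then 0 else y)"
proof (rule computes.comp[where ys = "[v, x]"])
  show "list_all2 (\<lambda>g y. computes p g [x] y) [b, Proj 0] [v, x]"
    using assms(1) computes.proj[of 0 "[x]" p] by auto
  have base: "computes p (PrimRec Zero (Comp c [Proj 2])) [0, x] 0"
    by (intro computes.intros)
  show "computes p (PrimRec Zero (Comp c [Proj 2])) [v, x] (if v = 0 then 0 else y)"
  proof (cases "v = 0")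
    case False
    then have "computes p c [x] y" "v = Suc 0" using assms(2) by auto
    moreover from this have "computes p (Comp c [Proj 2]) [0, 0, x] y"
      using computes.proj[of 2 "[0, 0, x]" p] by (intro computes.comp[where ys = "[x]"]) auto
    ultimately show ?thesis using base by (auto intro: computes.prim_Suc)
  qed (use base in simp)
qed

lemma lazy_conditional:
  "\<exists>e. \<forall>p x v y. computes p t [x] v \<longrightarrow>
    computes p (if v = 0 then c else d) [x] y \<longrightarrow> computes p e [x] y"
proof -
  have "functional 1 (\<lambda>p xs. 1 - xs ! 0)" "functional 1 (\<lambda>p xs. 1 - (1 - xs ! 0))"
    "functional 2 (\<lambda>p xs. xs ! 0 + xs ! 1)"
    by (intro functional_intros; simp)+
  then obtain n s a where n: "\<And>p x. computes p n [x] (1 - x)"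
    and s: "\<And>p x. computes p s [x] (1 - (1 - x))"
    and a: "\<And>p xs. length xs = 2 \<Longrightarrow> computes p a xs (xs ! 0 + xs ! 1)"
    unfolding functional_def[of 2] by (elim functionalE) blast
  define guarded where "guarded b c = Comp (PrimRec Zero (Comp c [Proj 2])) [b, Proj 0]" for b c
  show ?thesis
  proof (intro exI allI impI)
    fix p x v y
    assume t: "computes p t [x] v" and y: "computes p (if v = 0 then c else d) [x] y"
    have "computes p (guarded (Comp n [t]) c) [x] (if 1 - v = 0 then 0 else y)"
      unfolding guarded_def using computes_Comp1[OF t n] y
      by (intro computes_guarded) (auto split: if_splits)
    moreover have "computes p (guarded (Comp s [t]) d) [x] (if 1 - (1 - v) = 0 then 0 else y)"
      unfolding guarded_def using computes_Comp1[OF t s] y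
      by (intro computes_guarded) (auto split: if_splits)
    moreover have "computes p a [if 1 - v = 0 then 0 else y, if 1 - (1 - v) = 0 then 0 else y] y"
      using a[of "[if 1 - v = 0 then 0 else y, if 1 - (1 - v) = 0 then 0 else y]" p]
      by (cases v) auto
    ultimately show "computes p (Comp a [guarded (Comp n [t]) c, guarded (Comp s [t]) d]) [x] y"
      by (intro computes.comp) auto
  qed
qed

lemma produces_pair:
  "\<exists>e. \<forall>w p q. produces c w p \<longrightarrow> produces d w q \<longrightarrow> produces e w (pairb p q)"
proof -
  have "functional 1 (\<lambda>p xs. xs ! 0 mod 2)" "functional 1 (\<lambda>p xs. xs ! 0 div 2)"
    by (intro functional_intros functional_mod2; simp)+
  then obtain t h where t: "\<And>p x. computes p t [x] (x mod 2)"
    and h: "\<And>p x. computes p h [x] (x div 2)"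
    by (elim functionalE) blast
  obtain e where e: "\<And>p x v y. computes p t [x] v \<Longrightarrow>
    computes p (if v = 0 then Comp c [h] else Comp d [h]) [x] y \<Longrightarrow> computes p e [x] y"
    using lazy_conditional[of t "Comp c [h]" "Comp d [h]"] by blast
  show ?thesis
  proof (intro exI allI impI)
    fix w p q assume "produces c w p" "produces d w q"
    then show "produces e w (pairb p q)"
      unfolding produces_def pairb_def
      by (intro allI e[OF t]) (auto simp: even_iff_mod_2_eq_zero intro!: computes_Comp1[OF h])
  qed
qed

lemma computable_pair:
  assumes "computable_fun F" "computable_fun G"
  shows "computable_fun (\<lambda>p. Option.bind (F p) (\<lambda>q. map_option (pairb q) (G p)))"
proof -
  obtain c where c: "\<And>p q. F p = Some q \<Longrightarrow> produces c p q"
    using assms(1) unfolding computable_fun_iff by blast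
  obtain d where d: "\<And>p q. G p = Some q \<Longrightarrow> produces d p q"
    using assms(2) unfolding computable_fun_iff by blast
  obtain e where "\<And>w p q. produces c w p \<Longrightarrow> produces d w q \<Longrightarrow> produces e w (pairb p q)"
    using produces_pair[of c d] by blast
  with c d show ?thesis unfolding computable_fun_iff
    by (intro exI[of _ e]) (auto simp: bind_eq_Some_conv)
qed

lemma computable_cases:
  assumes t: "functional 1 (\<lambda>p xs. t p)" and F: "computable_fun F" and G: "computable_fun G"
  shows "computable_fun (\<lambda>p. if t p = 0 then F p else G p)"
proof -
  obtain b where b: "\<And>p x. computes p b [x] (t p)"
    using functionalE[OF t] by blast
  obtain c where c: "\<And>p q. F p = Some q \<Longrightarrow> produces c p q"
    using F unfolding computable_fun_iff by blast
  obtain d where d: "\<And>p q. G p = Some q \<Longrightarrow> produces d p q"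
    using G unfolding computable_fun_iff by blast
  obtain e where e: "\<And>p x v y. computes p b [x] v \<Longrightarrow>
    computes p (if v = 0 then c else d) [x] y \<Longrightarrow> computes p e [x] y"
    using lazy_conditional[of b c d] by blast
  have "produces e p q" if "(if t p = 0 then F p else G p) = Some q" for p q
    unfolding produces_def
    using that c[of p q] d[of p q] by (intro allI e[OF b]) (auto simp: produces_def split: if_splits)
  then show ?thesis unfolding computable_fun_iff by blast
qed

text \<open>
  A program may query the zero oracle without producing more sequences, because the queries can
  be replaced by the constant program.  Hence computable sequences inherit the closure properties
  of computable functions.
\<close>

lemma computable_seq_iff: "computable_seq q \<longleftrightarrow> (\<exists>c. produces c (\<lambda>_. 0) q)"
proof
  assume "\<exists>c. produces c (\<lambda>_. 0) q"
  then obtain c where "produces c (\<lambda>_. 0) q" by blast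
  then have "computes (\<lambda>_. 0) (Comp (relativize (Comp Zero [Proj 0]) 1 c) [Proj 0, Zero]) [n] (q n)"
    for n
    using produces_relativize[of c "\<lambda>_. 0" q Zero "\<lambda>_. 0"]
    by (auto simp: produces_def computes.zero)
  then show "computable_seq q"
    unfolding computable_seq_def
    by (intro exI[of _ "Comp (relativize (Comp Zero [Proj 0]) 1 c) [Proj 0, Zero]"])
      (auto intro: oracle_free_relativize)
qed (auto simp: computable_seq_def produces_def)

lemma computable_seq_uniform:
  assumes "computable_seq q"
  shows "computable_fun (\<lambda>p. Some q)"
proof -
  obtain c where "oracle_free c" "\<And>n. computes (\<lambda>_. 0) c [n] (q n)"
    using assms unfolding computable_seq_def by blast
  then have "produces c p q" for p unfolding produces_def by (metis computes_oracle_free)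
  then show ?thesis unfolding computable_fun_iff by auto
qed

lemma computable_seq_image:
  assumes "computable_fun F" "computable_seq p" "F p = Some q"
  shows "computable_seq q"
proof -
  obtain c where "produces c p q" using assms(1,3) unfolding computable_fun_iff by blast
  moreover obtain d where "produces d (\<lambda>_. 0) p" using assms(2) unfolding computable_seq_iff by blast
  ultimately show ?thesis unfolding computable_seq_iff by (blast intro: produces_relativize)
qed

lemma computable_seq_pair:
  assumes "computable_seq p" "computable_seq q"
  shows "computable_seq (pairb p q)"
  using computable_seq_image[OF computable_pair[OF computable_seq_uniform[OF assms(1)]
        computable_seq_uniform[OF assms(2)]] assms(1)] by simp

lemma computable_seq_const: "computable_seq (\<lambda>_. 0)"
  unfolding computable_seq_def by (intro exI[of _ Zero]) (auto intro: computes.zero)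

section \<open>Problems as relations between names\<close>

text \<open>
  Reducibility depends on a problem only through the relation between names of instances and
  names of their solutions.  Since every solution of a problem has a name, the names of instances
  are exactly the domain \<open>Ex (S p)\<close> of this relation \<open>S\<close>.
\<close>

type_synonym name_rel = "baire \<Rightarrow> baire \<Rightarrow> bool"

definition solves :: "'a mvfun \<Rightarrow> name_rel" where
  "solves f p r \<longleftrightarrow> (\<exists>x y. repn (src f) p = Some x \<and> repn (tgt f) r = Some y \<and> y \<in> vals f x)"

text \<open>
  Weihrauch reducibility with realizers eliminated: \<open>K\<close> translates instances, and \<open>H\<close> translates
  back every solution that the translated instance has.
\<close>

definition rel_le :: "name_rel \<Rightarrow> name_rel \<Rightarrow> bool" where
  "rel_le S T \<longleftrightarrow> (\<exists>H K. computable_fun H \<and> computable_fun K \<and>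
     (\<forall>p. Ex (S p) \<longrightarrow> (\<exists>k. K p = Some k \<and> Ex (T k) \<and>
        (\<forall>r. T k r \<longrightarrow> (\<exists>q. H (pairb p r) = Some q \<and> S p q)))))"

definition par_rel :: "name_rel \<Rightarrow> name_rel" where
  "par_rel S p r \<longleftrightarrow> (\<forall>i. S (nthb p i) (nthb r i))"

definition prod_rel :: "name_rel \<Rightarrow> name_rel \<Rightarrow> name_rel" where
  "prod_rel S T p r \<longleftrightarrow> S (fstb p) (fstb r) \<and> T (sndb p) (sndb r)"

text \<open>
  The direct sum is defined only on pairs of points from both domains, hence the two solvability
  conditions even though a single instance gets solved.
\<close>

definition sum_rel :: "name_rel \<Rightarrow> name_rel \<Rightarrow> name_rel" where
  "sum_rel S T p r \<longleftrightarrow> Ex (S (fstb p)) \<and> Ex (T (sndb p)) \<and>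
     (if r 0 = 0 then S (fstb p) (\<lambda>n. r (Suc n)) else T (sndb p) (\<lambda>n. r (Suc n)))"

definition regular :: "'a mvfun \<Rightarrow> bool" where
  "regular f \<longleftrightarrow> represented (src f) \<and> represented (tgt f) \<and> wf_mvfun f"

lemma solvable_iff:
  assumes "regular f"
  shows "Ex (solves f p) \<longleftrightarrow> (\<exists>x. repn (src f) p = Some x \<and> x \<in> mdom f)"
proof
  assume "\<exists>x. repn (src f) p = Some x \<and> x \<in> mdom f"
  then obtain x y where x: "repn (src f) p = Some x" "y \<in> vals f x"
    unfolding mdom_def by blast
  moreover from x(2) have "y \<in> points (tgt f)"
    using assms unfolding regular_def wf_mvfun_def by blast
  then obtain r where "repn (tgt f) r = Some y"
    using assms unfolding regular_def by (metis points_repnE)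
  ultimately show "Ex (solves f p)" unfolding solves_def by blast
qed (auto simp: solves_def mdom_def)

lemma realizes_iff:
  assumes "regular f"
  shows "realizes F f \<longleftrightarrow> (\<forall>p. Ex (solves f p) \<longrightarrow> (\<exists>q. F p = Some q \<and> solves f p q))"
  unfolding realizes_def solvable_iff[OF assms] by (auto simp: solves_def)

lemma has_computable_point_iff:
  assumes "regular f"
  shows "has_computable_point f \<longleftrightarrow> (\<exists>p. computable_seq p \<and> Ex (solves f p))"
  unfolding has_computable_point_def computable_point_def solvable_iff[OF assms] by blast

lemma realizer_on_instances:
  assumes "regular g"
  shows "\<exists>G. realizes G g \<and> (\<forall>k. G k \<noteq> None \<longrightarrow> Ex (solves g k))"
  by (rule exI[of _ "\<lambda>k. if Ex (solves g k) then Some (SOME r. solves g k r) else None"])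
    (simp add: realizes_iff[OF assms] someI_ex)

text \<open>
  Quantifying over all realizers amounts to quantifying, for each single instance, over all of its
  solutions: a realizer may be changed at one name to return any prescribed solution, and one
  that is undefined at all names of non-instances forces \<open>K p\<close> to name an instance.
\<close>

lemma weihrauch_le_Fn_iff:
  assumes f: "regular f" and g: "regular g"
  shows "Fn f \<le>\<^sub>W Fn g \<longleftrightarrow> rel_le (solves f) (solves g)"
proof
  assume "Fn f \<le>\<^sub>W Fn g"
  then obtain H K where comp: "computable_fun H" "computable_fun K"
    and red: "\<And>G. realizes G g \<Longrightarrow>
      realizes (\<lambda>p. Option.bind (Option.bind (K p) G) (\<lambda>r. H (pairb p r))) f"
    unfolding weihrauch_le_def by auto
  obtain G0 where G0: "realizes G0 g" and instance_only: "\<And>k. G0 k \<noteq> None \<Longrightarrow> Ex (solves g k)"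
    using realizer_on_instances[OF g] by blast
  have "\<exists>k. K p = Some k \<and> Ex (solves g k) \<and>
      (\<forall>r. solves g k r \<longrightarrow> (\<exists>q. H (pairb p r) = Some q \<and> solves f p q))"
    if p: "Ex (solves f p)" for p
  proof -
    from red[OF G0] p obtain k where k: "K p = Some k" "G0 k \<noteq> None"
      unfolding realizes_iff[OF f] by (fastforce simp: bind_eq_Some_conv)
    have "\<exists>q. H (pairb p r) = Some q \<and> solves f p q" if r: "solves g k r" for r
    proof -
      have "realizes (G0(k \<mapsto> r)) g"
        using G0 r unfolding realizes_iff[OF g] by auto
      from red[OF this] p show ?thesis
        unfolding realizes_iff[OF f] by (auto simp: k(1))
    qed
    with k(1) instance_only[OF k(2)] show ?thesis by blast
  qed
  with comp show "rel_le (solves f) (solves g)" unfolding rel_le_def by blast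
next
  assume "rel_le (solves f) (solves g)"
  then obtain H K where comp: "computable_fun H" "computable_fun K"
    and red: "\<And>p. Ex (solves f p) \<Longrightarrow> \<exists>k. K p = Some k \<and> Ex (solves g k) \<and>
      (\<forall>r. solves g k r \<longrightarrow> (\<exists>q. H (pairb p r) = Some q \<and> solves f p q))"
    unfolding rel_le_def by blast
  have "realizes (\<lambda>p. Option.bind (Option.bind (K p) G) (\<lambda>r. H (pairb p r))) f"
    if G: "realizes G g" for G
    unfolding realizes_iff[OF f]
  proof (intro allI impI)
    fix p assume "Ex (solves f p)"
    from red[OF this] obtain k where k: "K p = Some k" "Ex (solves g k)"
      and H: "\<And>r. solves g k r \<Longrightarrow> \<exists>q. H (pairb p r) = Some q \<and> solves f p q" by blast
    from G k(2) obtain r where "G k = Some r" "solves g k r"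
      unfolding realizes_iff[OF g] by blast
    with H k(1) show "\<exists>q. Option.bind (Option.bind (K p) G) (\<lambda>r. H (pairb p r)) = Some q \<and> solves f p q"
      by auto
  qed
  with comp show "Fn f \<le>\<^sub>W Fn g" unfolding weihrauch_le_def by auto
qed

lemma repn_prod_space: "repn (prod_space X U) r = Some z \<longleftrightarrow>
    (\<exists>x u. z = Couple x u \<and> repn X (fstb r) = Some x \<and> repn U (sndb r) = Some u)"
  by (auto simp: prod_space_def split: option.splits)

lemma repn_power_space: "repn (power_space X) r = Some z \<longleftrightarrow>
    (\<exists>s. z = Seq s \<and> (\<forall>i. repn X (nthb r i) = Some (s i)))"
proof
  assume "repn (power_space X) r = Some z"
  then have "\<forall>i. repn X (nthb r i) \<noteq> None" "z = Seq (\<lambda>i. the (repn X (nthb r i)))"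
    unfolding power_space_def by (simp_all split: if_split_asm)
  then show "\<exists>s. z = Seq s \<and> (\<forall>i. repn X (nthb r i) = Some (s i))" by auto
qed (auto simp: power_space_def)

lemma solves_parallel_mv: "solves (parallel_mv f) = par_rel (solves f)"
proof (intro ext iffI)
  fix p r assume "solves (parallel_mv f) p r"
  then show "par_rel (solves f) p r"
    by (fastforce simp: solves_def parallel_mv_def par_rel_def repn_power_space)
next
  fix p r assume "par_rel (solves f) p r"
  then obtain s t where "\<And>i. repn (src f) (nthb p i) = Some (s i)"
    "\<And>i. repn (tgt f) (nthb r i) = Some (t i)" "\<And>i. t i \<in> vals f (s i)"
    unfolding par_rel_def solves_def by metis
  then show "solves (parallel_mv f) p r"
    by (auto simp: solves_def parallel_mv_def repn_power_space)
qed

lemma solves_prod_mv: "solves (prod_mv f g) = prod_rel (solves f) (solves g)"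
  by (simp add: fun_eq_iff solves_def prod_mv_def prod_rel_def repn_prod_space) blast

lemma solves_sum_mv:
  assumes "regular f" "regular g"
  shows "solves (sum_mv f g) = sum_rel (solves f) (solves g)"
  by (intro ext iffI)
    (auto simp: sum_rel_def solvable_iff[OF assms(1)] solvable_iff[OF assms(2)]
      solves_def sum_mv_def repn_prod_space sum_space_def split: if_splits)

lemma wf_mvfun_iff:
  "wf_mvfun f \<longleftrightarrow> (\<forall>x y. y \<in> vals f x \<longrightarrow> x \<in> points (src f) \<and> y \<in> points (tgt f))"
  unfolding wf_mvfun_def mdom_def by blast

lemma regular_parallel_mv: "regular f \<Longrightarrow> regular (parallel_mv f)"
  by (auto simp: regular_def wf_mvfun_iff parallel_mv_def represented_power_space)
    (auto simp: power_space_def)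

lemma regular_prod_mv: "regular f \<Longrightarrow> regular g \<Longrightarrow> regular (prod_mv f g)"
  by (auto simp: regular_def wf_mvfun_iff prod_mv_def represented_prod_space)
    (auto simp: prod_space_def)

lemma regular_sum_mv: "regular f \<Longrightarrow> regular g \<Longrightarrow> regular (sum_mv f g)"
  by (auto simp: regular_def wf_mvfun_iff sum_mv_def mdom_def represented_prod_space represented_sum_space)
    (auto simp: prod_space_def sum_space_def)

section \<open>Reducibility of relations between names\<close>

lemma rel_leI:
  assumes "computable_fun H" "computable_fun K"
    and "\<And>p s. S p s \<Longrightarrow> \<exists>k. K p = Some k \<and> Ex (T k) \<and>
        (\<forall>r. T k r \<longrightarrow> (\<exists>q. H (pairb p r) = Some q \<and> S p q))"
  shows "rel_le S T"
  using assms unfolding rel_le_def by blast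

lemma rel_le_totalI:
  assumes "functional 1 (\<lambda>p xs. H p (xs ! 0))" "functional 1 (\<lambda>p xs. K p (xs ! 0))"
    and "\<And>p s. S p s \<Longrightarrow> Ex (T (K p))" "\<And>p r. T (K p) r \<Longrightarrow> Ex (S p) \<Longrightarrow> S p (H (pairb p r))"
  shows "rel_le S T"
  by (rule rel_leI[OF computable_total[OF assms(1)] computable_total[OF assms(2)]])
    (use assms(3,4) in blast)

lemma rel_le_refl: "rel_le S S"
proof (rule rel_le_totalI[where H = sndb and K = "\<lambda>p. p"])
  show "functional 1 (\<lambda>p xs. p (xs ! 0))" by (intro functional_intros) simp
  show "functional 1 (\<lambda>p xs. sndb p (xs ! 0))" unfolding sndb_def by (intro functional_intros) simp
qed auto

lemma rel_le_trans:
  assumes "rel_le S T" "rel_le T U"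
  shows "rel_le S U"
proof -
  from assms(1) obtain H K where HK: "computable_fun H" "computable_fun K"
    and ST: "\<And>p. Ex (S p) \<Longrightarrow> \<exists>k. K p = Some k \<and> Ex (T k) \<and>
      (\<forall>r. T k r \<longrightarrow> (\<exists>q. H (pairb p r) = Some q \<and> S p q))"
    unfolding rel_le_def by blast
  from assms(2) obtain H' K' where HK': "computable_fun H'" "computable_fun K'"
    and TU: "\<And>p. Ex (T p) \<Longrightarrow> \<exists>k. K' p = Some k \<and> Ex (U k) \<and>
      (\<forall>r. U k r \<longrightarrow> (\<exists>q. H' (pairb p r) = Some q \<and> T p q))"
    unfolding rel_le_def by blast
  have fst: "computable_fun (\<lambda>p. Some (fstb p))" and snd: "computable_fun (\<lambda>p. Some (sndb p))"
    by (intro computable_total; unfold fstb_def sndb_def; intro functional_intros; simp)+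
  \<comment> \<open>The solution passes through \<open>T\<close>: on \<open>\<langle>p, r\<rangle>\<close> the function \<open>L\<close> yields
    \<open>\<langle>K p, r\<rangle>\<close>, and \<open>H''\<close> yields \<open>H \<langle>p, H' \<langle>K p, r\<rangle>\<rangle>\<close>.\<close>
  define L where "L w = Option.bind (Option.bind (Some (fstb w)) K) (\<lambda>k. map_option (pairb k) (Some (sndb w)))" for w
  define H'' where "H'' w = Option.bind (Option.bind (Some (fstb w))
     (\<lambda>p. map_option (pairb p) (Option.bind (L w) H'))) H" for w
  have L: "computable_fun L"
    unfolding L_def by (intro computable_pair computable_bind fst snd HK)
  have H'': "computable_fun H''"
    unfolding H''_def by (intro computable_bind[OF computable_pair] computable_bind fst L HK HK')
  show ?thesis
  proof (rule rel_leI[OF H'' computable_bind[OF HK(2) HK'(2)]])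
    fix p s assume "S p s"
    then obtain k where k: "K p = Some k" "Ex (T k)"
      and H: "\<And>r. T k r \<Longrightarrow> \<exists>q. H (pairb p r) = Some q \<and> S p q"
      using ST by blast
    from TU[OF k(2)] obtain k' where k': "K' k = Some k'" "Ex (U k')"
      and H': "\<And>r. U k' r \<Longrightarrow> \<exists>q. H' (pairb k r) = Some q \<and> T k q" by blast
    have "\<exists>q. H'' (pairb p r) = Some q \<and> S p q" if r: "U k' r" for r
    proof -
      from H'[OF r] obtain t where "H' (pairb k r) = Some t" "T k t" by blast
      with H k(1) show ?thesis by (auto simp: H''_def L_def)
    qed
    with k k' show "\<exists>k. Option.bind (K p) K' = Some k \<and> Ex (U k) \<and>
        (\<forall>r. U k r \<longrightarrow> (\<exists>q. H'' (pairb p r) = Some q \<and> S p q))" by auto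
  qed
qed

lemma rel_le_computable_instance:
  assumes "rel_le S T" "computable_seq p" "Ex (S p)"
  shows "\<exists>k. computable_seq k \<and> Ex (T k)"
  using assms unfolding rel_le_def by (metis computable_seq_image)

lemma Ex_par_rel: "Ex (par_rel S p) \<longleftrightarrow> (\<forall>i. Ex (S (nthb p i)))"
proof
  assume "\<forall>i. Ex (S (nthb p i))"
  then obtain r where "\<And>i. S (nthb p i) (r i)" by metis
  then have "par_rel S p (tupleb r)" by (simp add: par_rel_def)
  then show "Ex (par_rel S p)" by blast
qed (unfold par_rel_def, blast)

lemma Ex_prod_rel: "Ex (prod_rel S T p) \<longleftrightarrow> Ex (S (fstb p)) \<and> Ex (T (sndb p))"
proof
  assume "Ex (S (fstb p)) \<and> Ex (T (sndb p))"
  then obtain a b where "S (fstb p) a" "T (sndb p) b" by blast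
  then have "prod_rel S T p (pairb a b)" by (simp add: prod_rel_def)
  then show "Ex (prod_rel S T p)" by blast
qed (auto simp: prod_rel_def)

lemma sum_rel_left: "S (fstb p) a \<Longrightarrow> Ex (T (sndb p)) \<Longrightarrow> sum_rel S T p (case_nat 0 a)"
  by (auto simp: sum_rel_def)

lemma Ex_sum_rel: "Ex (sum_rel S T p) \<longleftrightarrow> Ex (S (fstb p)) \<and> Ex (T (sndb p))"
  using sum_rel_left[of S p _ T] unfolding sum_rel_def by blast

section \<open>Parallelization is a closure operator\<close>

lemma par_rel_mono:
  assumes "rel_le S T"
  shows "rel_le (par_rel S) (par_rel T)"
proof -
  from assms obtain H K where HK: "computable_fun H" "computable_fun K"
    and ST: "\<And>p. Ex (S p) \<Longrightarrow> \<exists>k. K p = Some k \<and> Ex (T k) \<and>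
      (\<forall>r. T k r \<longrightarrow> (\<exists>q. H (pairb p r) = Some q \<and> S p q))"
    unfolding rel_le_def by blast
  define all where "all F p = (if \<forall>n. F (nthb p n) \<noteq> None
      then Some (tupleb (\<lambda>n. the (F (nthb p n)))) else None)" for F :: "baire \<rightharpoonup> baire" and p
  define zip where "zip w = tupleb (\<lambda>i. pairb (nthb (fstb w) i) (nthb (sndb w) i))" for w
  have "functional 1 (\<lambda>w xs. zip w (xs ! 0))"
    unfolding zip_def tupleb_def pairb_def nthb_def fstb_def sndb_def case_prod_beta
    by (intro functional_intros) auto
  then have zip: "computable_fun (\<lambda>w. Some (zip w))" by (rule computable_total)
  have all: "computable_fun (all F)" if "computable_fun F" for F
    unfolding all_def by (rule computable_tuple[OF that])
  show ?thesis
  proof (rule rel_leI[OF computable_bind[OF zip all[OF HK(1)]] all[OF HK(2)]])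
    fix p s assume "par_rel S p s"
    then have "\<forall>i. \<exists>k. K (nthb p i) = Some k \<and> Ex (T k) \<and>
        (\<forall>r. T k r \<longrightarrow> (\<exists>q. H (pairb (nthb p i) r) = Some q \<and> S (nthb p i) q))"
      unfolding par_rel_def using ST by blast
    from choice[OF this] obtain k where k: "\<And>i. K (nthb p i) = Some (k i)" "\<And>i. Ex (T (k i))"
      and H: "\<And>i r. T (k i) r \<Longrightarrow> \<exists>q. H (pairb (nthb p i) r) = Some q \<and> S (nthb p i) q"
      by blast
    have "\<exists>q. Option.bind (Some (zip (pairb p r))) (all H) = Some q \<and> par_rel S p q"
      if r: "par_rel T (tupleb k) r" for r
    proof -
      have "\<forall>i. \<exists>q. H (pairb (nthb p i) (nthb r i)) = Some q \<and> S (nthb p i) q"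
        using H r by (simp add: par_rel_def)
      then obtain q where "\<And>i. H (pairb (nthb p i) (nthb r i)) = Some (q i)"
        "\<And>i. S (nthb p i) (q i)" by metis
      then show ?thesis by (simp add: zip_def all_def par_rel_def)
    qed
    moreover have "all K p = Some (tupleb k)" by (simp add: all_def k(1))
    moreover have "Ex (par_rel T (tupleb k))" by (simp add: Ex_par_rel k(2))
    ultimately show "\<exists>k. all K p = Some k \<and> Ex (par_rel T k) \<and>
      (\<forall>r. par_rel T k r \<longrightarrow> (\<exists>q. Option.bind (Some (zip (pairb p r))) (all H) = Some q \<and> par_rel S p q))"
      by blast
  qed
qed

lemma par_rel_extensive: "rel_le S (par_rel S)"
proof (rule rel_le_totalI[where H = "\<lambda>w. nthb (sndb w) 0" and K = "\<lambda>p. tupleb (\<lambda>i. p)"])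
  show "functional 1 (\<lambda>p xs. tupleb (\<lambda>i. p) (xs ! 0))"
    unfolding tupleb_def case_prod_beta by (intro functional_intros) auto
  show "functional 1 (\<lambda>w xs. nthb (sndb w) 0 (xs ! 0))"
    unfolding nthb_def sndb_def by (intro functional_intros) auto
qed (simp_all add: Ex_par_rel, auto simp: par_rel_def)

text \<open>
  A double sequence of instances is turned into a sequence by the bijective coding of pairs.
\<close>

lemma par_rel_idempotent: "rel_le (par_rel (par_rel S)) (par_rel S)"
proof -
  define flat where "flat p = tupleb (\<lambda>n. case prod_decode n of (i, j) \<Rightarrow> nthb (nthb p i) j)" for p
  define nest where "nest r = tupleb (\<lambda>i. tupleb (\<lambda>j. nthb r (prod_encode (i, j))))" for r
  show ?thesis
  proof (rule rel_le_totalI[where H = "\<lambda>w. nest (sndb w)" and K = flat])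
    show "functional 1 (\<lambda>p xs. flat p (xs ! 0))"
      unfolding flat_def tupleb_def nthb_def case_prod_beta by (intro functional_intros) auto
    show "functional 1 (\<lambda>w xs. nest (sndb w) (xs ! 0))"
      unfolding nest_def tupleb_def nthb_def sndb_def case_prod_beta by (intro functional_intros) auto
  next
    fix p s assume "par_rel (par_rel S) p s"
    then show "Ex (par_rel S (flat p))"
      by (auto simp: Ex_par_rel par_rel_def flat_def split: prod.split)
  next
    fix p r assume r: "par_rel S (flat p) r"
    have "S (nthb (nthb p i) j) (nthb r (prod_encode (i, j)))" for i j
      using r[unfolded par_rel_def, rule_format, of "prod_encode (i, j)"] by (simp add: flat_def)
    then show "par_rel (par_rel S) p (nest (sndb (pairb p r)))"
      by (simp add: par_rel_def nest_def)
  qed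
qed

lemma par_rel_least: "rel_le S (par_rel T) \<Longrightarrow> rel_le (par_rel S) (par_rel T)"
  by (blast intro: rel_le_trans par_rel_mono par_rel_idempotent)

section \<open>Products are least upper bounds\<close>

text \<open>
  The second factor has to be fed with some instance, and \<open>K\<close> must be able to compute it.  This
  is where problems need a computable instance: without one, the product may fail to be an
  upper bound.
\<close>

lemma rel_le_prod_left:
  assumes "computable_seq c" "Ex (T c)"
  shows "rel_le S (prod_rel S T)"
proof (rule rel_leI[where H = "\<lambda>w. Some (fstb (sndb w))" and K = "\<lambda>p. Some (pairb p c)"])
  have "computable_fun (\<lambda>p. Some p)"
    by (rule computable_total) (intro functional_intros, simp)
  from computable_pair[OF this computable_seq_uniform[OF assms(1)]]
  show "computable_fun (\<lambda>p. Some (pairb p c))" by simp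
  show "computable_fun (\<lambda>w. Some (fstb (sndb w)))"
    by (rule computable_total, unfold fstb_def sndb_def, intro functional_intros, simp)
qed (use assms(2) in \<open>auto simp: Ex_prod_rel\<close>, auto simp: prod_rel_def)

lemma prod_rel_swap: "rel_le (prod_rel S T) (prod_rel T S)"
proof (rule rel_le_totalI[where H = "\<lambda>w. pairb (sndb (sndb w)) (fstb (sndb w))"
      and K = "\<lambda>p. pairb (sndb p) (fstb p)"])
  show "functional 1 (\<lambda>p xs. pairb (sndb p) (fstb p) (xs ! 0))"
    "functional 1 (\<lambda>w xs. pairb (sndb (sndb w)) (fstb (sndb w)) (xs ! 0))"
    unfolding pairb_def fstb_def sndb_def by (intro functional_intros; simp)+
qed (simp_all only: Ex_prod_rel, auto simp: prod_rel_def)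

lemma rel_le_prod_right:
  assumes "computable_seq c" "Ex (S c)"
  shows "rel_le T (prod_rel S T)"
  by (blast intro: rel_le_trans prod_rel_swap rel_le_prod_left[of c S T] assms)

lemma prod_rel_mono:
  assumes "rel_le S S'" "rel_le T T'"
  shows "rel_le (prod_rel S T) (prod_rel S' T')"
proof -
  from assms(1) obtain H K where HK: "computable_fun H" "computable_fun K"
    and S: "\<And>p. Ex (S p) \<Longrightarrow> \<exists>k. K p = Some k \<and> Ex (S' k) \<and>
      (\<forall>r. S' k r \<longrightarrow> (\<exists>q. H (pairb p r) = Some q \<and> S p q))"
    unfolding rel_le_def by blast
  from assms(2) obtain H' K' where HK': "computable_fun H'" "computable_fun K'"
    and T: "\<And>p. Ex (T p) \<Longrightarrow> \<exists>k. K' p = Some k \<and> Ex (T' k) \<and>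
      (\<forall>r. T' k r \<longrightarrow> (\<exists>q. H' (pairb p r) = Some q \<and> T p q))"
    unfolding rel_le_def by blast
  define par where "par F G w = Option.bind (Option.bind (Some (fstb w)) F)
      (\<lambda>q. map_option (pairb q) (Option.bind (Some (sndb w)) G))" for F G :: "baire \<rightharpoonup> baire" and w
  have par: "computable_fun (par F G)" if "computable_fun F" "computable_fun G" for F G
    unfolding par_def
    by (intro computable_pair computable_bind[OF computable_total] that;
        unfold fstb_def sndb_def; intro functional_intros; simp)
  \<comment> \<open>Each backward translation needs its own instance next to its own solution, so the two
    inner components of \<open>\<langle>\<langle>p, p'\<rangle>, \<langle>r, r'\<rangle>\<rangle>\<close> are interchanged.\<close>
  define mid where "mid w = pairb (pairb (fstb (fstb w)) (fstb (sndb w)))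
      (pairb (sndb (fstb w)) (sndb (sndb w)))" for w
  have "functional 1 (\<lambda>w xs. mid w (xs ! 0))"
    unfolding mid_def pairb_def fstb_def sndb_def by (intro functional_intros; simp)
  then have mid: "computable_fun (\<lambda>w. Some (mid w))" by (rule computable_total)
  show ?thesis
  proof (rule rel_leI[OF computable_bind[OF mid par[OF HK(1) HK'(1)]] par[OF HK(2) HK'(2)]])
    fix p s assume "prod_rel S T p s"
    then have p: "Ex (S (fstb p))" "Ex (T (sndb p))" by (auto simp: prod_rel_def)
    from S[OF p(1)] obtain k where k: "K (fstb p) = Some k" "Ex (S' k)"
      and H: "\<And>r. S' k r \<Longrightarrow> \<exists>q. H (pairb (fstb p) r) = Some q \<and> S (fstb p) q" by blast
    from T[OF p(2)] obtain k' where k': "K' (sndb p) = Some k'" "Ex (T' k')"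
      and H': "\<And>r. T' k' r \<Longrightarrow> \<exists>q. H' (pairb (sndb p) r) = Some q \<and> T (sndb p) q" by blast
    have "\<exists>q. Option.bind (Some (mid (pairb p r))) (par H H') = Some q \<and> prod_rel S T p q"
      if r: "prod_rel S' T' (pairb k k') r" for r
      using H[of "fstb r"] H'[of "sndb r"] r by (auto simp: prod_rel_def mid_def par_def)
    moreover have "par K K' p = Some (pairb k k')" by (simp add: par_def k(1) k'(1))
    moreover have "Ex (prod_rel S' T' (pairb k k'))" by (simp add: Ex_prod_rel k(2) k'(2))
    ultimately show "\<exists>k. par K K' p = Some k \<and> Ex (prod_rel S' T' k) \<and>
        (\<forall>r. prod_rel S' T' k r \<longrightarrow>
          (\<exists>q. Option.bind (Some (mid (pairb p r))) (par H H') = Some q \<and> prod_rel S T p q))"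
      by blast
  qed
qed

text \<open>
  Two sequences of instances are merged into a single one: the first is put at the even and the
  second at the odd positions.
\<close>

lemma prod_rel_par_rel: "rel_le (prod_rel (par_rel S) (par_rel S)) (par_rel S)"
proof -
  define merge where "merge p = tupleb (\<lambda>n. if even n then nthb (fstb p) (n div 2) else nthb (sndb p) (n div 2))" for p
  define split where "split r = pairb (tupleb (\<lambda>n. nthb r (2 * n))) (tupleb (\<lambda>n. nthb r (Suc (2 * n))))" for r
  have merge': "merge p = (\<lambda>m. if even (fst (prod_decode m))
      then nthb (fstb p) (fst (prod_decode m) div 2) (snd (prod_decode m))
      else nthb (sndb p) (fst (prod_decode m) div 2) (snd (prod_decode m)))" for p
    by (auto simp: merge_def tupleb_def case_prod_beta)
  show ?thesis
  proof (rule rel_le_totalI[where H = "\<lambda>w. split (sndb w)" and K = merge])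
    show "functional 1 (\<lambda>p xs. merge p (xs ! 0))"
      unfolding merge' nthb_def fstb_def sndb_def by (intro functional_intros) auto
    show "functional 1 (\<lambda>w xs. split (sndb w) (xs ! 0))"
      unfolding split_def pairb_def tupleb_def nthb_def sndb_def case_prod_beta
      by (intro functional_intros) auto
  next
    fix p s assume "prod_rel (par_rel S) (par_rel S) p s"
    then show "Ex (par_rel S (merge p))"
      by (auto simp: prod_rel_def par_rel_def Ex_par_rel merge_def)
  next
    fix p r assume r: "par_rel S (merge p) r"
    have "S (nthb (fstb p) n) (nthb r (2 * n))" for n
      using r[unfolded par_rel_def, rule_format, of "2 * n"] by (simp add: merge_def)
    moreover have "S (nthb (sndb p) n) (nthb r (Suc (2 * n)))" for n
      using r[unfolded par_rel_def, rule_format, of "Suc (2 * n)"] by (simp add: merge_def)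
    ultimately show "prod_rel (par_rel S) (par_rel S) p (split (sndb (pairb p r)))"
      by (simp add: prod_rel_def par_rel_def split_def)
  qed
qed

lemma prod_rel_least:
  "rel_le S (par_rel U) \<Longrightarrow> rel_le T (par_rel U) \<Longrightarrow> rel_le (prod_rel S T) (par_rel U)"
  by (blast intro: rel_le_trans prod_rel_mono prod_rel_par_rel)

section \<open>Sums are greatest lower bounds\<close>

lemma computable_prefix: "computable_fun (\<lambda>w. Some (case_nat m (sndb w)))"
proof (rule computable_total)
  have "case_nat m (sndb w) x = (if x = 0 then m else sndb w (x - 1))" for w x
    by (simp split: nat.split)
  then show "functional 1 (\<lambda>w xs. case_nat m (sndb w) (xs ! 0))"
    unfolding sndb_def by (simp only:) (intro functional_intros, auto)
qed

lemma sum_rel_le_left: "rel_le (sum_rel S T) S"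
proof (rule rel_leI[OF computable_prefix[of 0] computable_total[of fstb]])
  show "functional 1 (\<lambda>w xs. fstb w (xs ! 0))" unfolding fstb_def by (intro functional_intros) simp
qed (auto simp: sum_rel_def)

lemma sum_rel_le_right: "rel_le (sum_rel S T) T"
proof (rule rel_leI[OF computable_prefix[of 1] computable_total[of sndb]])
  show "functional 1 (\<lambda>w xs. sndb w (xs ! 0))" unfolding sndb_def by (intro functional_intros) simp
qed (auto simp: sum_rel_def)

text \<open>
  Both reductions are prepared at once, and the tag of the answer that comes back tells which of
  them to complete.  Nothing is known about the other one on this answer, so the distinction of
  cases must be lazy.
\<close>

lemma sum_rel_greatest:
  assumes "rel_le U S" "rel_le U T"
  shows "rel_le U (sum_rel S T)"
proof -
  from assms(1) obtain H K where HK: "computable_fun H" "computable_fun K"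
    and S: "\<And>p. Ex (U p) \<Longrightarrow> \<exists>k. K p = Some k \<and> Ex (S k) \<and>
      (\<forall>r. S k r \<longrightarrow> (\<exists>q. H (pairb p r) = Some q \<and> U p q))"
    unfolding rel_le_def by blast
  from assms(2) obtain H' K' where HK': "computable_fun H'" "computable_fun K'"
    and T: "\<And>p. Ex (U p) \<Longrightarrow> \<exists>k. K' p = Some k \<and> Ex (T k) \<and>
      (\<forall>r. T k r \<longrightarrow> (\<exists>q. H' (pairb p r) = Some q \<and> U p q))"
    unfolding rel_le_def by blast
  define untag where "untag w = pairb (fstb w) (\<lambda>n. sndb w (Suc n))" for w
  have "functional 1 (\<lambda>w xs. untag w (xs ! 0))"
    unfolding untag_def pairb_def fstb_def sndb_def by (intro functional_intros; simp)
  then have untag: "computable_fun (\<lambda>w. Some (untag w))" by (rule computable_total)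
  have tag: "functional 1 (\<lambda>w xs. sndb w 0)"
    unfolding sndb_def by (intro functional_intros)
  let ?H = "\<lambda>w. if sndb w 0 = 0 then Option.bind (Some (untag w)) H else Option.bind (Some (untag w)) H'"
  let ?K = "\<lambda>p. Option.bind (K p) (\<lambda>k. map_option (pairb k) (K' p))"
  show ?thesis
  proof (rule rel_leI[where H = ?H and K = ?K])
    show "computable_fun ?H"
      by (intro computable_cases tag computable_bind untag HK HK')
    show "computable_fun ?K" by (intro computable_pair HK HK')
    fix p s assume "U p s"
    then have p: "Ex (U p)" by blast
    from S[OF p] obtain k where k: "K p = Some k" "Ex (S k)"
      and H: "\<And>r. S k r \<Longrightarrow> \<exists>q. H (pairb p r) = Some q \<and> U p q" by blast
    from T[OF p] obtain k' where k': "K' p = Some k'" "Ex (T k')"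
      and H': "\<And>r. T k' r \<Longrightarrow> \<exists>q. H' (pairb p r) = Some q \<and> U p q" by blast
    have "\<exists>q. ?H (pairb p r) = Some q \<and> U p q" if "sum_rel S T (pairb k k') r" for r
      using that H H' by (auto simp: sum_rel_def untag_def split: if_splits)
    moreover have "Ex (sum_rel S T (pairb k k'))" by (simp add: Ex_sum_rel k(2) k'(2))
    ultimately show "\<exists>k. ?K p = Some k \<and> Ex (sum_rel S T k) \<and>
        (\<forall>r. sum_rel S T k r \<longrightarrow> (\<exists>q. ?H (pairb p r) = Some q \<and> U p q))"
      by (simp add: k(1) k'(1))
  qed
qed

section \<open>Computable relations\<close>

definition computable_rel :: "name_rel \<Rightarrow> bool" where
  "computable_rel S \<longleftrightarrow> (\<exists>F. computable_fun F \<and> (\<forall>p. Ex (S p) \<longrightarrow> (\<exists>q. F p = Some q \<and> S p q)))"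

lemma computable_mvfun_iff: "regular f \<Longrightarrow> computable_mvfun f \<longleftrightarrow> computable_rel (solves f)"
  unfolding computable_mvfun_def computable_rel_def by (simp add: realizes_iff)

text \<open>
  Any fixed computable instance may be submitted to \<open>T\<close>, since its solution is ignored.
\<close>

lemma computable_rel_le:
  assumes "computable_rel S" "computable_seq c" "Ex (T c)"
  shows "rel_le S T"
proof -
  obtain F where F: "computable_fun F" "\<And>p. Ex (S p) \<Longrightarrow> \<exists>q. F p = Some q \<and> S p q"
    using assms(1) unfolding computable_rel_def by blast
  have fst: "computable_fun (\<lambda>w. Some (fstb w))"
    by (rule computable_total, unfold fstb_def, intro functional_intros, simp)
  show ?thesis
  proof (rule rel_leI[OF computable_bind[OF fst F(1)] computable_seq_uniform[OF assms(2)]])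
    fix p s assume "S p s"
    then show "\<exists>k. Some c = Some k \<and> Ex (T k) \<and> (\<forall>r. T k r \<longrightarrow>
        (\<exists>q. Option.bind (Some (fstb (pairb p r))) F = Some q \<and> S p q))"
      using F(2)[of p] assms(3) by auto
  qed
qed

lemma computable_rel_mono:
  assumes "rel_le S T" "computable_rel T"
  shows "computable_rel S"
proof -
  from assms(1) obtain H K where HK: "computable_fun H" "computable_fun K"
    and ST: "\<And>p. Ex (S p) \<Longrightarrow> \<exists>k. K p = Some k \<and> Ex (T k) \<and>
      (\<forall>r. T k r \<longrightarrow> (\<exists>q. H (pairb p r) = Some q \<and> S p q))"
    unfolding rel_le_def by blast
  obtain F where F: "computable_fun F" "\<And>p. Ex (T p) \<Longrightarrow> \<exists>q. F p = Some q \<and> T p q"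
    using assms(2) unfolding computable_rel_def by blast
  have id: "computable_fun (\<lambda>p. Some p)"
    by (rule computable_total) (intro functional_intros, simp)
  define G where "G p = Option.bind (Option.bind (Some p)
      (\<lambda>p'. map_option (pairb p') (Option.bind (K p) F))) H" for p
  have "computable_fun G"
    unfolding G_def by (intro computable_bind[OF computable_pair] computable_bind id HK F)
  moreover have "\<exists>q. G p = Some q \<and> S p q" if "Ex (S p)" for p
    using ST[OF that] F(2) by (fastforce simp: G_def)
  ultimately show ?thesis unfolding computable_rel_def by blast
qed

lemma computable_par_rel:
  assumes "computable_rel S"
  shows "computable_rel (par_rel S)"
proof -
  obtain F where F: "computable_fun F" "\<And>p. Ex (S p) \<Longrightarrow> \<exists>q. F p = Some q \<and> S p q"
    using assms unfolding computable_rel_def by blast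
  have "\<exists>q. (if \<forall>n. F (nthb p n) \<noteq> None then Some (tupleb (\<lambda>n. the (F (nthb p n)))) else None) = Some q
      \<and> par_rel S p q" if "Ex (par_rel S p)" for p
  proof -
    from that have "\<forall>i. \<exists>q. F (nthb p i) = Some q \<and> S (nthb p i) q"
      using F(2) unfolding Ex_par_rel by blast
    then obtain q where "\<And>i. F (nthb p i) = Some (q i)" "\<And>i. S (nthb p i) (q i)" by metis
    then show ?thesis by (simp add: par_rel_def)
  qed
  with computable_tuple[OF F(1)] show ?thesis unfolding computable_rel_def by blast
qed

section \<open>Parallel reducibility of problems\<close>

lemma ex_realizer: "regular g \<Longrightarrow> \<exists>G. realizes G g"
  using realizer_on_instances by blast

lemma problems_regular: "admissible R \<Longrightarrow> Fn f \<in> problems R \<Longrightarrow> regular f"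
  by (simp add: problems_def admissible_def regular_def)

lemma problems_Void: "Void \<in> problems R"
  by (simp add: problems_def)

lemma parallel_le_Void: "f \<le>\<^sub>P Void"
  unfolding parallel_le_def weihrauch_le_def computable_fun_def
  by (intro exI[of _ "\<lambda>_. None"]) simp

lemma Void_parallel_le_iff:
  assumes "admissible R" "g \<in> problems R"
  shows "Void \<le>\<^sub>P g \<longleftrightarrow> g = Void"
proof (cases g)
  case (Fn g')
  then obtain G where "realizes G (parallel_mv g')"
    using ex_realizer[OF regular_parallel_mv] problems_regular assms by blast
  then show ?thesis unfolding parallel_le_def weihrauch_le_def Fn by auto
qed (simp add: parallel_le_Void)

lemma parallel_le_Fn_iff:
  "regular f \<Longrightarrow> regular g \<Longrightarrow>
    Fn f \<le>\<^sub>P Fn g \<longleftrightarrow> rel_le (par_rel (solves f)) (par_rel (solves g))"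
  unfolding parallel_le_def
  by (simp add: weihrauch_le_Fn_iff regular_parallel_mv solves_parallel_mv)

lemma parallel_le_refl:
  assumes "admissible R" "f \<in> problems R"
  shows "f \<le>\<^sub>P f"
proof (cases f)
  case (Fn f')
  then have "regular f'" using assms problems_regular by blast
  then show ?thesis by (simp add: Fn parallel_le_Fn_iff rel_le_refl)
qed (simp add: parallel_le_Void)

lemma parallel_le_trans:
  assumes R: "admissible R" and P: "f \<in> problems R" "g \<in> problems R" "h \<in> problems R"
    and le: "f \<le>\<^sub>P g" "g \<le>\<^sub>P h"
  shows "f \<le>\<^sub>P h"
proof (cases h)
  case h: (Fn h')
  then obtain g' where g: "g = Fn g'"
    using le(2) P Void_parallel_le_iff[OF R] by (cases g) auto
  then obtain f' where f: "f = Fn f'"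
    using le(1) P Void_parallel_le_iff[OF R] by (cases f) auto
  have "regular f'" "regular g'" "regular h'" using P problems_regular[OF R] by (auto simp: f g h)
  with le show ?thesis by (auto simp: f g h parallel_le_Fn_iff intro: rel_le_trans)
qed (simp add: parallel_le_Void)

definition pointed_problems :: "'a rspace set \<Rightarrow> 'a problem set" where
  "pointed_problems R = {f \<in> problems R. \<forall>f'. f = Fn f' \<longrightarrow> has_computable_point f'}"

lemma pointed_problems_subset: "f \<in> pointed_problems R \<Longrightarrow> f \<in> problems R"
  by (simp add: pointed_problems_def)

lemma pointed_problems_Void: "Void \<in> pointed_problems R"
  by (simp add: pointed_problems_def problems_Void)

lemma pointed_Fn_iff:
  assumes "admissible R" "Fn f \<in> problems R"
  shows "Fn f \<in> pointed_problems R \<longleftrightarrow> (\<exists>p. computable_seq p \<and> Ex (solves f p))"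
  using has_computable_point_iff[OF problems_regular[OF assms]] assms(2)
  by (simp add: pointed_problems_def)

lemma pointed_Fn_instance:
  assumes "admissible R" "Fn f \<in> pointed_problems R"
  obtains p where "computable_seq p" "Ex (solves f p)"
  using assms pointed_Fn_iff pointed_problems_subset by blast

text \<open>
  A reduction of parallelizations maps the constant sequence of a computable instance of \<open>f\<close>
  to a computable sequence of instances of \<open>g\<close>, of which the first is taken.  Hence every
  representative of a degree in \<open>W_hat R\<close> has a computable instance.
\<close>

lemma pointed_problems_upward:
  assumes R: "admissible R" and f: "f \<in> pointed_problems R" and g: "g \<in> problems R" and le: "f \<le>\<^sub>P g"
  shows "g \<in> pointed_problems R"
proof (cases g)
  case Void
  then show ?thesis by (simp add: pointed_problems_Void)
next
  case (Fn g')
  then obtain f' where f': "f = Fn f'"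
    using le g Void_parallel_le_iff[OF R] by (cases f) auto
  obtain p where p: "computable_seq p" "Ex (solves f' p)"
    using f unfolding f' by (rule pointed_Fn_instance[OF R])
  have "regular f'" "regular g'"
    using f g pointed_problems_subset problems_regular[OF R] by (auto simp: f' Fn)
  then have "rel_le (par_rel (solves f')) (par_rel (solves g'))"
    using le by (simp add: f' Fn parallel_le_Fn_iff)
  then have "rel_le (solves f') (par_rel (solves g'))"
    by (rule rel_le_trans[OF par_rel_extensive])
  with p obtain k where k: "computable_seq k" "Ex (par_rel (solves g') k)"
    using rel_le_computable_instance[of "solves f'" "par_rel (solves g')" p] by blast
  have "computable_fun (\<lambda>k. Some (nthb k 0))"
    by (rule computable_total, unfold nthb_def, intro functional_intros, simp)
  from computable_seq_image[OF this k(1) refl] have "computable_seq (nthb k 0)" .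
  then show ?thesis using k(2) g Ex_par_rel[of "solves g'" k]
    unfolding Fn pointed_Fn_iff[OF R g[unfolded Fn]] by blast
qed

lemma admissible_closed:
  assumes "admissible R"
  shows "X \<in> R \<Longrightarrow> Y \<in> R \<Longrightarrow> prod_space X Y \<in> R" "X \<in> R \<Longrightarrow> Y \<in> R \<Longrightarrow> sum_space X Y \<in> R"
    "X \<in> R \<Longrightarrow> power_space X \<in> R"
  using assms by (simp_all add: admissible_def)

lemma Fn_in_problems_iff:
  assumes "admissible R"
  shows "Fn f \<in> problems R \<longleftrightarrow> src f \<in> R \<and> tgt f \<in> R \<and> regular f"
  using assms by (auto simp: problems_def admissible_def regular_def)

lemma prod_prob_in_problems:
  assumes R: "admissible R" and "f \<in> problems R" "g \<in> problems R"
  shows "prod_prob f g \<in> problems R"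
proof (cases "f = Void \<or> g = Void")
  case False
  then obtain f' g' where "f = Fn f'" "g = Fn g'" by (meson problem.exhaust)
  with assms show ?thesis
    by (simp add: Fn_in_problems_iff[OF R] regular_prod_mv)
      (simp add: prod_mv_def admissible_closed[OF R])
qed (use problems_Void in \<open>cases f; auto\<close>)

lemma psum_prob_in_problems:
  assumes R: "admissible R" and "f \<in> problems R" "g \<in> problems R"
  shows "psum_prob f g \<in> problems R"
proof (cases "f = Void \<or> g = Void")
  case False
  then obtain f' g' where "f = Fn f'" "g = Fn g'" by (meson problem.exhaust)
  with assms show ?thesis
    by (simp add: Fn_in_problems_iff[OF R] regular_sum_mv regular_parallel_mv)
      (simp add: sum_mv_def parallel_mv_def admissible_closed[OF R])
qed (use assms in \<open>cases f; cases g; auto\<close>)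

text \<open>
  A product with \<open>Void\<close> is \<open>Void\<close>, which lies above everything; the other products are
  handled by the computable instances of both factors.
\<close>

lemma prod_prob_upper:
  assumes R: "admissible R" and f: "f \<in> pointed_problems R" and g: "g \<in> pointed_problems R"
  shows "f \<le>\<^sub>P prod_prob f g" "g \<le>\<^sub>P prod_prob f g"
proof -
  have "f \<le>\<^sub>P prod_prob f g \<and> g \<le>\<^sub>P prod_prob f g"
  proof (cases "f = Void \<or> g = Void")
    case True
    then have "prod_prob f g = Void" by (cases f) auto
    then show ?thesis by (simp add: parallel_le_Void)
  next
    case False
    then obtain f' g' where fg: "f = Fn f'" "g = Fn g'" by (meson problem.exhaust)
    obtain p where p: "computable_seq p" "Ex (solves f' p)"
      using f unfolding fg by (rule pointed_Fn_instance[OF R])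
    obtain q where q: "computable_seq q" "Ex (solves g' q)"
      using g unfolding fg by (rule pointed_Fn_instance[OF R])
    have "regular f'" "regular g'"
      using f g pointed_problems_subset problems_regular[OF R] by (auto simp: fg)
    then show ?thesis
      by (simp add: fg parallel_le_Fn_iff regular_prod_mv solves_prod_mv par_rel_mono
          rel_le_prod_left[of q "solves g'", OF q] rel_le_prod_right[of p "solves f'", OF p])
  qed
  then show "f \<le>\<^sub>P prod_prob f g" "g \<le>\<^sub>P prod_prob f g" by simp_all
qed

text \<open>
  The parallelization of \<open>h\<close> can answer two instances at once, so it absorbs the product; being
  closed under parallelization, it also absorbs the parallelized product.
\<close>

lemma prod_prob_least:
  assumes R: "admissible R" and P: "f \<in> problems R" "g \<in> problems R" "h \<in> problems R"
    and le: "f \<le>\<^sub>P h" "g \<le>\<^sub>P h"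
  shows "prod_prob f g \<le>\<^sub>P h"
proof (cases h)
  case h: (Fn h')
  obtain f' g' where fg: "f = Fn f'" "g = Fn g'"
    using le P(3) Void_parallel_le_iff[OF R] h by (metis problem.exhaust problem.distinct(1))
  have reg: "regular f'" "regular g'" "regular h'" using P problems_regular[OF R] by (auto simp: fg h)
  then have "rel_le (par_rel (solves f')) (par_rel (solves h'))"
    "rel_le (par_rel (solves g')) (par_rel (solves h'))"
    using le by (simp_all add: fg h parallel_le_Fn_iff)
  then have "rel_le (solves f') (par_rel (solves h'))" "rel_le (solves g') (par_rel (solves h'))"
    by (simp_all add: rel_le_trans[OF par_rel_extensive])
  then have "rel_le (par_rel (prod_rel (solves f') (solves g'))) (par_rel (solves h'))"
    by (intro par_rel_least prod_rel_least)
  with reg show ?thesis by (simp add: fg h parallel_le_Fn_iff regular_prod_mv solves_prod_mv)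
qed (simp add: parallel_le_Void)

text \<open>
  The summands are parallelized in advance for the sake of this lemma: many instances of
  \<open>f \<oplus> g\<close> might be answered on the left for some of them and on the right for others,
  but each single instance of the sum reduces to the closed problem given by the parallelization
  of \<open>f\<close>, and then so do infinitely many.
\<close>

lemma psum_prob_lower:
  assumes R: "admissible R" and P: "f \<in> problems R" "g \<in> problems R"
  shows "psum_prob f g \<le>\<^sub>P f" "psum_prob f g \<le>\<^sub>P g"
proof -
  have "psum_prob f g \<le>\<^sub>P f \<and> psum_prob f g \<le>\<^sub>P g"
  proof (cases "f = Void \<or> g = Void")
    case True
    then show ?thesis
      using parallel_le_refl[OF R] P by (cases f; cases g) (auto simp: parallel_le_Void)
  next
    case False
    then obtain f' g' where fg: "f = Fn f'" "g = Fn g'" by (meson problem.exhaust)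
    have "regular f'" "regular g'" using P problems_regular[OF R] by (auto simp: fg)
    then show ?thesis
      by (simp add: fg parallel_le_Fn_iff regular_sum_mv regular_parallel_mv solves_sum_mv
          solves_parallel_mv par_rel_least sum_rel_le_left sum_rel_le_right)
  qed
  then show "psum_prob f g \<le>\<^sub>P f" "psum_prob f g \<le>\<^sub>P g" by simp_all
qed

lemma psum_prob_greatest:
  assumes R: "admissible R" and P: "f \<in> problems R" "g \<in> problems R" "h \<in> problems R"
    and le: "h \<le>\<^sub>P f" "h \<le>\<^sub>P g"
  shows "h \<le>\<^sub>P psum_prob f g"
proof (cases "f = Void \<or> g = Void")
  case True
  then show ?thesis using le by (cases f; cases g) auto
next
  case False
  then obtain f' g' where fg: "f = Fn f'" "g = Fn g'" by (meson problem.exhaust)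
  obtain h' where h: "h = Fn h'"
    using le P(1) Void_parallel_le_iff[OF R] fg by (metis problem.exhaust problem.distinct(1))
  have reg: "regular f'" "regular g'" "regular h'" using P problems_regular[OF R] by (auto simp: fg h)
  then have "rel_le (par_rel (solves h')) (par_rel (solves f'))"
    "rel_le (par_rel (solves h')) (par_rel (solves g'))"
    using le by (simp_all add: fg h parallel_le_Fn_iff)
  then have "rel_le (par_rel (solves h')) (par_rel (sum_rel (par_rel (solves f')) (par_rel (solves g'))))"
    by (blast intro: rel_le_trans sum_rel_greatest par_rel_extensive)
  with reg show ?thesis
    by (simp add: fg h parallel_le_Fn_iff regular_sum_mv regular_parallel_mv solves_sum_mv solves_parallel_mv)
qed

lemma prod_prob_pointed:
  assumes R: "admissible R" and f: "f \<in> pointed_problems R" and g: "g \<in> pointed_problems R"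
  shows "prod_prob f g \<in> pointed_problems R"
  using pointed_problems_upward[OF R f _ prod_prob_upper(1)[OF R f g]]
    prod_prob_in_problems[OF R] f g pointed_problems_subset by blast

lemma psum_prob_pointed:
  assumes R: "admissible R" and f: "f \<in> pointed_problems R" and g: "g \<in> pointed_problems R"
  shows "psum_prob f g \<in> pointed_problems R"
proof (cases "f = Void \<or> g = Void")
  case True
  then show ?thesis using f g by (cases f; cases g) auto
next
  case False
  then obtain f' g' where fg: "f = Fn f'" "g = Fn g'" by (meson problem.exhaust)
  obtain p where p: "computable_seq p" "Ex (solves f' p)"
    using f unfolding fg by (rule pointed_Fn_instance[OF R])
  obtain q where q: "computable_seq q" "Ex (solves g' q)"
    using g unfolding fg by (rule pointed_Fn_instance[OF R])
  have reg: "regular f'" "regular g'"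
    using f g pointed_problems_subset problems_regular[OF R] by (auto simp: fg)
  have P: "psum_prob f g \<in> problems R"
    using psum_prob_in_problems[OF R] f g pointed_problems_subset by blast
  have "computable_fun (\<lambda>p. Some (tupleb (\<lambda>_. p)))"
    by (rule computable_total, unfold tupleb_def case_prod_beta, intro functional_intros, simp)
  then have "computable_seq (pairb (tupleb (\<lambda>_. p)) (tupleb (\<lambda>_. q)))"
    by (intro computable_seq_pair computable_seq_image[OF _ p(1) refl] computable_seq_image[OF _ q(1) refl])
  moreover have "Ex (sum_rel (par_rel (solves f')) (par_rel (solves g'))
      (pairb (tupleb (\<lambda>_. p)) (tupleb (\<lambda>_. q))))"
    using p(2) q(2) by (simp add: Ex_sum_rel Ex_par_rel)
  ultimately show ?thesis
    using P reg by (auto simp: fg pointed_Fn_iff[OF R] solves_sum_mv regular_parallel_mv solves_parallel_mv)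
qed

section \<open>Degrees and operations on them\<close>

lemma mem_degree_iff:
  "g \<in> degree R f \<longleftrightarrow> f \<in> problems R \<and> g \<in> problems R \<and> f \<le>\<^sub>P g \<and> g \<le>\<^sub>P f"
  by (auto simp: degree_def parallel_equiv_def)

lemma degree_self: "admissible R \<Longrightarrow> f \<in> problems R \<Longrightarrow> f \<in> degree R f"
  by (simp add: mem_degree_iff parallel_le_refl)

lemma degree_eqI:
  assumes R: "admissible R" and P: "f \<in> problems R" "g \<in> problems R" and "f \<le>\<^sub>P g" "g \<le>\<^sub>P f"
  shows "degree R f = degree R g"
  using assms parallel_le_trans[OF R] unfolding mem_degree_iff set_eq_iff by blast

lemma degree_le_iff:
  assumes R: "admissible R" and P: "f \<in> problems R" "g \<in> problems R"
  shows "degree_le (degree R f) (degree R g) \<longleftrightarrow> f \<le>\<^sub>P g"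
proof
  assume "degree_le (degree R f) (degree R g)"
  then obtain f' g' where "f' \<in> degree R f" "g' \<in> degree R g" "f' \<le>\<^sub>P g'"
    unfolding degree_le_def by blast
  then show "f \<le>\<^sub>P g" unfolding mem_degree_iff by (meson parallel_le_trans[OF R])
qed (use assms degree_self in \<open>auto simp: degree_le_def\<close>)

text \<open>
  The problem \<open>Void\<close> counts as pointed, so that \<open>0\<close> needs no separate treatment.
\<close>

lemma W_hat_eq: "W_hat R = degree R ` pointed_problems R"
proof
  show "W_hat R \<subseteq> degree R ` pointed_problems R"
    by (auto simp: W_hat_def zero_degree_def pointed_problems_def problems_Void)
  show "degree R ` pointed_problems R \<subseteq> W_hat R"
  proof
    fix a assume "a \<in> degree R ` pointed_problems R"
    then obtain f where "f \<in> pointed_problems R" "a = degree R f" by blast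
    then show "a \<in> W_hat R"
      by (cases f) (auto simp: W_hat_def zero_degree_def pointed_problems_def)
  qed
qed

text \<open>
  The union that defines an operation on degrees collapses to a single degree as soon as the
  operation respects equivalence.
\<close>

lemma degree_operation:
  assumes R: "admissible R" and P: "f \<in> problems R" "g \<in> problems R"
    and mono: "\<And>f' g'. f' \<in> degree R f \<Longrightarrow> g' \<in> degree R g \<Longrightarrow> degree R (m f' g') = degree R (m f g)"
  shows "(\<Union>f'\<in>degree R f. \<Union>g'\<in>degree R g. degree R (m f' g')) = degree R (m f g)"
  using mono degree_self[OF R P(1)] degree_self[OF R P(2)] by blast

lemma degree_prod_degree:
  assumes R: "admissible R" and f: "f \<in> pointed_problems R" and g: "g \<in> pointed_problems R"
  shows "degree_prod R (degree R f) (degree R g) = degree R (prod_prob f g)"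
  unfolding degree_prod_def
proof (rule degree_operation[OF R])
  fix f' g' assume f': "f' \<in> degree R f" and g': "g' \<in> degree R g"
  have pointed: "f' \<in> pointed_problems R" "g' \<in> pointed_problems R"
    using f' g' f g pointed_problems_upward[OF R] unfolding mem_degree_iff by blast+
  note P = pointed[THEN pointed_problems_subset] f[THEN pointed_problems_subset]
    g[THEN pointed_problems_subset]
  have mono: "prod_prob x y \<le>\<^sub>P prod_prob x' y'"
    if "x \<in> problems R" "y \<in> problems R" "x' \<in> pointed_problems R" "y' \<in> pointed_problems R"
      "x \<le>\<^sub>P x'" "y \<le>\<^sub>P y'" for x y x' y'
  proof -
    note P' = that(3,4)[THEN pointed_problems_subset]
    note prod = prod_prob_in_problems[OF R P']
    show ?thesis
      by (rule prod_prob_least[OF R that(1,2) prod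
            parallel_le_trans[OF R that(1) P'(1) prod that(5) prod_prob_upper(1)[OF R that(3,4)]]
            parallel_le_trans[OF R that(2) P'(2) prod that(6) prod_prob_upper(2)[OF R that(3,4)]]])
  qed
  show "degree R (prod_prob f' g') = degree R (prod_prob f g)"
    using f' g' P pointed f g unfolding mem_degree_iff
    by (intro degree_eqI[OF R] mono prod_prob_in_problems[OF R]) auto
qed (use f g pointed_problems_subset in blast)+

lemma degree_sum_degree:
  assumes R: "admissible R" and f: "f \<in> problems R" and g: "g \<in> problems R"
  shows "degree_sum R (degree R f) (degree R g) = degree R (psum_prob f g)"
  unfolding degree_sum_def
proof (rule degree_operation[OF R f g])
  fix f' g' assume f': "f' \<in> degree R f" and g': "g' \<in> degree R g"
  have mono: "psum_prob x y \<le>\<^sub>P psum_prob x' y'"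
    if "x \<in> problems R" "y \<in> problems R" "x' \<in> problems R" "y' \<in> problems R"
      "x \<le>\<^sub>P x'" "y \<le>\<^sub>P y'" for x y x' y'
  proof -
    note sum = psum_prob_in_problems[OF R that(1,2)]
    show ?thesis
      by (rule psum_prob_greatest[OF R that(3,4) sum
            parallel_le_trans[OF R sum that(1,3) psum_prob_lower(1)[OF R that(1,2)] that(5)]
            parallel_le_trans[OF R sum that(2,4) psum_prob_lower(2)[OF R that(1,2)] that(6)]])
  qed
  show "degree R (psum_prob f' g') = degree R (psum_prob f g)"
    using f' g' f g unfolding mem_degree_iff
    by (intro degree_eqI[OF R] mono psum_prob_in_problems[OF R]) auto
qed

text \<open>
  A computable problem with a computable instance; the degree of this representative is \<open>1\<close>.
\<close>

definition name_identity :: "'a mvfun" where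
  "name_identity = \<lparr>src = baire_space, tgt = baire_space, vals = (\<lambda>x. {x} \<inter> range Name)\<rparr>"

lemma solves_name_identity: "solves name_identity p r \<longleftrightarrow> p = r"
  by (auto simp: solves_def name_identity_def baire_space_def)

lemma name_identity_in_problems: "admissible R \<Longrightarrow> Fn name_identity \<in> problems R"
  by (auto simp: problems_def name_identity_def wf_mvfun_iff admissible_def)
    (auto simp: baire_space_def)

lemma name_identity_pointed:
  assumes R: "admissible R"
  shows "Fn name_identity \<in> pointed_problems R"
  unfolding pointed_Fn_iff[OF R name_identity_in_problems[OF R]]
  using computable_seq_const solves_name_identity by blast

lemma computable_name_identity: "computable_rel (solves name_identity)"
proof -
  have "computable_fun (\<lambda>p. Some p)"
    by (rule computable_total) (intro functional_intros, simp)
  then show ?thesis unfolding computable_rel_def by (intro exI[of _ Some]) (auto simp: solves_name_identity)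
qed

lemma computable_below_pointed:
  assumes R: "admissible R" and f: "Fn f \<in> problems R" "computable_mvfun f"
    and g: "g \<in> pointed_problems R"
  shows "Fn f \<le>\<^sub>P g"
proof (cases g)
  case (Fn g')
  obtain p where p: "computable_seq p" "Ex (solves g' p)"
    using g unfolding Fn by (rule pointed_Fn_instance[OF R])
  have "regular f" "regular g'"
    using f g pointed_problems_subset problems_regular[OF R] by (auto simp: Fn)
  then show ?thesis
    using f(2) p by (simp add: Fn parallel_le_Fn_iff computable_mvfun_iff par_rel_mono computable_rel_le)
qed (simp add: parallel_le_Void)

lemma one_degree_eq:
  assumes R: "admissible R"
  shows "one_degree R = degree R (Fn name_identity)"
proof (intro equalityI subsetI)
  let ?i = "name_identity :: 'a mvfun"
  have i: "Fn ?i \<in> problems R" "computable_mvfun ?i"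
    using name_identity_in_problems[OF R] problems_regular[OF R]
    by (auto simp: computable_mvfun_iff computable_name_identity)
  note i' = name_identity_pointed[OF R]
  fix f
  {
    assume "f \<in> one_degree R"
    then obtain f' where "f = Fn f'" "Fn f' \<in> problems R" "Fn f' \<in> pointed_problems R" "computable_mvfun f'"
      unfolding one_degree_def pointed_problems_def by blast
    with i i' show "f \<in> degree R (Fn ?i)"
      by (simp add: mem_degree_iff computable_below_pointed[OF R])
  }
  assume f: "f \<in> degree R (Fn ?i)"
  then obtain f' where f': "f = Fn f'"
    using Void_parallel_le_iff[OF R i(1)] by (cases f) (auto simp: mem_degree_iff)
  have P: "Fn f' \<in> problems R" "Fn f' \<in> pointed_problems R"
    using f i' pointed_problems_upward[OF R] unfolding f' mem_degree_iff by blast+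
  have reg: "regular f'" "regular ?i" using problems_regular[OF R] P i by auto
  then have "rel_le (par_rel (solves f')) (par_rel (solves ?i))"
    using f by (simp add: f' mem_degree_iff parallel_le_Fn_iff)
  then have "computable_rel (solves f')"
    by (rule computable_rel_mono[OF rel_le_trans[OF par_rel_extensive]])
      (rule computable_par_rel[OF computable_name_identity])
  with P show "f \<in> one_degree R"
    unfolding f' one_degree_def pointed_problems_def by (simp add: computable_mvfun_iff reg)
qed

section \<open>The lattice of parallel degrees\<close>

lemma is_lub_pairI:
  assumes "a \<in> carrier L" "b \<in> carrier L" "s \<in> carrier L" "le L a s" "le L b s"
    and "\<And>c. c \<in> carrier L \<Longrightarrow> le L a c \<Longrightarrow> le L b c \<Longrightarrow> le L s c"
  shows "is_lub L s {a, b}"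
  using assms by (auto simp: least_def Upper_def)

lemma is_glb_pairI:
  assumes "a \<in> carrier L" "b \<in> carrier L" "s \<in> carrier L" "le L s a" "le L s b"
    and "\<And>c. c \<in> carrier L \<Longrightarrow> le L c a \<Longrightarrow> le L c b \<Longrightarrow> le L c s"
  shows "is_glb L s {a, b}"
  using assms by (auto simp: greatest_def Lower_def)

text \<open>
  The monoid laws are order-theoretic: an operation that yields least upper bounds is associative
  and idempotent, and a least element is neutral for it.  Passing to the inverse order gives the
  version for greatest lower bounds.
\<close>

lemma lub_operation_monoid:
  fixes L (structure)
  assumes "partial_order L"
    and lub: "\<And>a b. a \<in> carrier L \<Longrightarrow> b \<in> carrier L \<Longrightarrow> is_lub L (m a b) {a, b}"
    and z: "least L z (carrier L)"
  shows "monoid \<lparr>carrier = carrier L, mult = m, one = z\<rparr>"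
    and "a \<in> carrier L \<Longrightarrow> m a a = a"
proof -
  interpret partial_order L by fact
  have closed: "m a b \<in> carrier L" and upper: "a \<sqsubseteq> m a b" "b \<sqsubseteq> m a b"
    and least: "\<And>c. c \<in> carrier L \<Longrightarrow> a \<sqsubseteq> c \<Longrightarrow> b \<sqsubseteq> c \<Longrightarrow> m a b \<sqsubseteq> c"
    if "a \<in> carrier L" "b \<in> carrier L" for a b
    using lub[OF that] that unfolding least_def Upper_def by auto
  have zc: "z \<in> carrier L" and z_le: "\<And>a. a \<in> carrier L \<Longrightarrow> z \<sqsubseteq> a"
    using z unfolding least_def by auto
  have assoc: "m (m a b) c = m a (m b c)"
    if "a \<in> carrier L" "b \<in> carrier L" "c \<in> carrier L" for a b c
  proof (rule le_antisym)
    note bc = upper[OF that(2,3)] closed[OF that(2,3)]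
    note ab = upper[OF that(1,2)] closed[OF that(1,2)]
    show "m (m a b) c \<sqsubseteq> m a (m b c)"
      using that bc ab upper[of a "m b c"] by (intro least closed) (auto intro: le_trans[of _ "m b c"] closed)
    show "m a (m b c) \<sqsubseteq> m (m a b) c"
      using that bc ab upper[of "m a b" c] by (intro least closed) (auto intro: le_trans[of _ "m a b"] closed)
  qed (use that closed in auto)
  have idem: "m a a = a" if "a \<in> carrier L" for a
    using that closed upper least by (intro le_antisym) auto
  have "m z a = a" "m a z = a" if "a \<in> carrier L" for a
    using that closed upper least zc z_le by (auto intro!: le_antisym)
  with closed zc assoc show "monoid \<lparr>carrier = carrier L, mult = m, one = z\<rparr>"
    by unfold_locales auto
  show "m a a = a" if "a \<in> carrier L" by (rule idem[OF that])
qed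

lemma glb_operation_monoid:
  assumes "partial_order L"
    and "\<And>a b. a \<in> carrier L \<Longrightarrow> b \<in> carrier L \<Longrightarrow> is_glb L (m a b) {a, b}"
    and "greatest L z (carrier L)"
  shows "monoid \<lparr>carrier = carrier L, mult = m, one = z\<rparr>"
    and "a \<in> carrier L \<Longrightarrow> m a a = a"
  using lub_operation_monoid[of "inv_gorder L" m z] assms
  by (simp_all add: dual_order_iff)

lemma partial_order_W_hat:
  assumes R: "admissible R"
  shows "partial_order (W_hat_order R)"
proof
  show "eq (W_hat_order R) a b" if "le (W_hat_order R) a b" "le (W_hat_order R) b a"
    "a \<in> carrier (W_hat_order R)" "b \<in> carrier (W_hat_order R)" for a b
  proof -
    obtain f g where fg: "f \<in> pointed_problems R" "a = degree R f" "g \<in> pointed_problems R" "b = degree R g"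
      using \<open>a \<in> _\<close> \<open>b \<in> _\<close> by (auto simp: W_hat_eq)
    note P = fg(1,3)[THEN pointed_problems_subset]
    from that(1,2) have "f \<le>\<^sub>P g" "g \<le>\<^sub>P f"
      by (simp_all add: fg(2,4) degree_le_iff[OF R] P)
    then have "a = b" unfolding fg(2,4) by (rule degree_eqI[OF R P])
    then show ?thesis by simp
  qed
  show "le (W_hat_order R) a c" if "le (W_hat_order R) a b" "le (W_hat_order R) b c"
    "a \<in> carrier (W_hat_order R)" "b \<in> carrier (W_hat_order R)" "c \<in> carrier (W_hat_order R)" for a b c
    using that by (auto simp: W_hat_eq degree_le_iff[OF R] pointed_problems_subset)
      (meson parallel_le_trans[OF R] pointed_problems_subset)
  show "le (W_hat_order R) a a" if "a \<in> carrier (W_hat_order R)" for a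
    using that by (auto simp: W_hat_eq degree_le_iff[OF R] pointed_problems_subset parallel_le_refl[OF R])
qed auto

lemma is_lub_degree_prod:
  assumes R: "admissible R" and "a \<in> W_hat R" "b \<in> W_hat R"
  shows "is_lub (W_hat_order R) (degree_prod R a b) {a, b}"
proof -
  obtain f g where fg: "f \<in> pointed_problems R" "g \<in> pointed_problems R"
    and ab: "a = degree R f" "b = degree R g"
    using assms by (auto simp: W_hat_eq)
  note P = fg[THEN pointed_problems_subset]
  show ?thesis
    unfolding ab degree_prod_degree[OF R fg]
    by (rule is_lub_pairI)
      (use fg P in \<open>auto simp: W_hat_eq degree_le_iff[OF R] prod_prob_pointed[OF R]
        prod_prob_in_problems[OF R] prod_prob_upper[OF R] prod_prob_least[OF R]
        pointed_problems_subset\<close>)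
qed

lemma is_glb_degree_sum:
  assumes R: "admissible R" and "a \<in> W_hat R" "b \<in> W_hat R"
  shows "is_glb (W_hat_order R) (degree_sum R a b) {a, b}"
proof -
  obtain f g where fg: "f \<in> pointed_problems R" "g \<in> pointed_problems R"
    and ab: "a = degree R f" "b = degree R g"
    using assms by (auto simp: W_hat_eq)
  note P = fg[THEN pointed_problems_subset]
  show ?thesis
    unfolding ab degree_sum_degree[OF R P]
    by (rule is_glb_pairI)
      (use fg P in \<open>auto simp: W_hat_eq degree_le_iff[OF R] psum_prob_pointed[OF R]
        psum_prob_in_problems[OF R] psum_prob_lower[OF R] psum_prob_greatest[OF R]
        pointed_problems_subset\<close>)
qed

lemma least_one_degree:
  assumes R: "admissible R"
  shows "least (W_hat_order R) (one_degree R) (W_hat R)"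
proof -
  have "degree_le (one_degree R) b" if b: "b \<in> W_hat R" for b
  proof -
    obtain g where g: "g \<in> pointed_problems R" "b = degree R g"
      using b by (auto simp: W_hat_eq)
    have i: "Fn name_identity \<in> problems R" "computable_mvfun (name_identity :: 'a mvfun)"
      using name_identity_in_problems[OF R] problems_regular[OF R]
      by (auto simp: computable_mvfun_iff computable_name_identity)
    show ?thesis
      unfolding one_degree_eq[OF R] g(2) degree_le_iff[OF R i(1) pointed_problems_subset[OF g(1)]]
      by (rule computable_below_pointed[OF R i g(1)])
  qed
  moreover have "one_degree R \<in> W_hat R"
    unfolding one_degree_eq[OF R] W_hat_eq by (rule imageI[OF name_identity_pointed[OF R]])
  ultimately show ?thesis by (simp add: least_def)
qed

lemma greatest_zero_degree:
  assumes R: "admissible R"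
  shows "greatest (W_hat_order R) (zero_degree R) (W_hat R)"
  unfolding greatest_def zero_degree_def
  by (auto simp: W_hat_eq degree_le_iff[OF R] pointed_problems_subset pointed_problems_Void
      problems_Void parallel_le_Void)

theorem theorem4p10:
  fixes R :: "'a rspace set"
  assumes "admissible R"
  shows
    "lattice (W_hat_order R) \<and>
     least (W_hat_order R) (one_degree R) (W_hat R) \<and>
     greatest (W_hat_order R) (zero_degree R) (W_hat R) \<and>
     (\<forall>a\<in>W_hat R. \<forall>b\<in>W_hat R.
        is_glb (W_hat_order R) (degree_sum R a b) {a, b} \<and>
        is_lub (W_hat_order R) (degree_prod R a b) {a, b}) \<and>
     monoid \<lparr>carrier = W_hat R, mult = degree_sum R, one = zero_degree R\<rparr> \<and>
     (\<forall>a\<in>W_hat R. degree_sum R a a = a) \<and>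
     monoid \<lparr>carrier = W_hat R, mult = degree_prod R, one = one_degree R\<rparr> \<and>
     (\<forall>a\<in>W_hat R. degree_prod R a a = a)"
proof -
  note po = partial_order_W_hat[OF assms]
  note lub = is_lub_degree_prod[OF assms] and glb = is_glb_degree_sum[OF assms]
  interpret partial_order "W_hat_order R" by (rule po)
  have "lattice (W_hat_order R)"
  proof unfold_locales
    fix a b assume "a \<in> carrier (W_hat_order R)" "b \<in> carrier (W_hat_order R)"
    then have "a \<in> W_hat R" "b \<in> W_hat R" by simp_all
    from lub[OF this] glb[OF this]
    show "\<exists>s. is_lub (W_hat_order R) s {a, b}" "\<exists>s. is_glb (W_hat_order R) s {a, b}"
      by blast+
  qed
  moreover note least_one_degree[OF assms] greatest_zero_degree[OF assms]
  moreover have "\<forall>a\<in>W_hat R. \<forall>b\<in>W_hat R.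
      is_glb (W_hat_order R) (degree_sum R a b) {a, b} \<and>
      is_lub (W_hat_order R) (degree_prod R a b) {a, b}"
    using lub glb by blast
  moreover have "monoid \<lparr>carrier = W_hat R, mult = degree_sum R, one = zero_degree R\<rparr>"
    "\<forall>a\<in>W_hat R. degree_sum R a a = a"
    using glb_operation_monoid[OF po, of "degree_sum R" "zero_degree R"] glb
      greatest_zero_degree[OF assms] by simp_all
  moreover have "monoid \<lparr>carrier = W_hat R, mult = degree_prod R, one = one_degree R\<rparr>"
    "\<forall>a\<in>W_hat R. degree_prod R a a = a"
    using lub_operation_monoid[OF po, of "degree_prod R" "one_degree R"] lub
      least_one_degree[OF assms] by simp_all
  ultimately show ?thesis by blast
qed

end
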